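(* Let $0<r<1$. Then the closed unit disk $\overline{\mathbb{D}}$ is a minimal spectral set for the class $C_{1,r}$.
   Context: All operators are bounded linear maps on complex Hilbert spaces. $C_{1,r}=\{T: T \text{ is invertible and } \|T\|\le1,\ \|rT^{-1}\|\le1\}$. For compact $X\subset\mathbb{C}$, $Rat(X)$ is the algebra of rational functions with poles off $X$; $X$ is a spectral set for an operator $T$ if $\sigma(T)\subseteq X$ and $\|f(T)\|\le\sup_{\xi\in X}|f(\xi)|$ for all $f\in Rat(X)$. A compact set $X$ is a minimal spectral set for a class $\mathcal{T}$ of operators if $X$ is a spectral set for every member of $\mathcal{T}$ and for every proper compact subset $X'$ of $X$ there is $T\in\mathcal{T}$ such that $X'$ is not a spectral set for $T$. *)

theory Defs
  imports
    "HOL-Analysis.Analysis"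
    "HOL-Algebra.Module"
    "HOL-Computational_Algebra.Polynomial"
begin

definition complex_ring :: "complex ring" where
  "complex_ring = \<lparr>carrier = UNIV, mult = (*), one = 1, zero = 0, add = (+)\<rparr>"

text \<open>
  Hilbert spaces are carrier-based, so that a class of operators may contain operators on
  many different Hilbert spaces.  The type variable is the universe from which the underlying
  sets are drawn; a nonzero complex Hilbert space contains a copy of the complex numbers, so a
  universe admits one iff the complex numbers inject into it.  The fields \<^const>\<open>mult\<close> and \<^const>\<open>one\<close>, which HOL-Algebra's modules inherit
  from its record of rings, play no role.
\<close>

record 'a inner_space = "(complex, 'a) module" +
  cinner :: "'a \<Rightarrow> 'a \<Rightarrow> complex"

definition hnorm :: "'a inner_space \<Rightarrow> 'a \<Rightarrow> real" where
  "hnorm H x = sqrt (Re (cinner H x x))"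

text \<open>The inner product is linear in its first argument.\<close>

locale complex_hilbert_space = Module.module complex_ring H for H :: "'a inner_space" (structure) +
  assumes cinner_add_left:
      "\<lbrakk>x \<in> carrier H; y \<in> carrier H; z \<in> carrier H\<rbrakk>
        \<Longrightarrow> cinner H (x \<oplus>\<^bsub>H\<^esub> y) z = cinner H x z + cinner H y z"
    and cinner_smult_left:
      "\<lbrakk>x \<in> carrier H; y \<in> carrier H\<rbrakk> \<Longrightarrow> cinner H (c \<odot>\<^bsub>H\<^esub> x) y = c * cinner H x y"
    and cinner_commute:
      "\<lbrakk>x \<in> carrier H; y \<in> carrier H\<rbrakk> \<Longrightarrow> cinner H y x = cnj (cinner H x y)"
    and cinner_ge_zero: "x \<in> carrier H \<Longrightarrow> 0 \<le> Re (cinner H x x)"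
    and cinner_eq_zero: "\<lbrakk>x \<in> carrier H; cinner H x x = 0\<rbrakk> \<Longrightarrow> x = \<zero>\<^bsub>H\<^esub>"
    and complete:
      "\<lbrakk>range s \<subseteq> carrier H;
        \<forall>\<epsilon>>0. \<exists>N. \<forall>m\<ge>N. \<forall>n\<ge>N. hnorm H (s m \<ominus>\<^bsub>H\<^esub> s n) < \<epsilon>\<rbrakk>
        \<Longrightarrow> \<exists>x\<in>carrier H. (\<lambda>n. hnorm H (s n \<ominus>\<^bsub>H\<^esub> x)) \<longlonglongrightarrow> 0"

text \<open>An operator on \<open>H\<close> is a function of which only the values on \<^term>\<open>carrier H\<close> matter.\<close>

definition bounded_operator :: "'a inner_space \<Rightarrow> ('a \<Rightarrow> 'a) \<Rightarrow> bool" where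
  "bounded_operator H T \<longleftrightarrow>
     T \<in> carrier H \<rightarrow> carrier H \<and>
     (\<forall>x\<in>carrier H. \<forall>y\<in>carrier H. T (x \<oplus>\<^bsub>H\<^esub> y) = T x \<oplus>\<^bsub>H\<^esub> T y) \<and>
     (\<forall>c. \<forall>x\<in>carrier H. T (c \<odot>\<^bsub>H\<^esub> x) = c \<odot>\<^bsub>H\<^esub> T x) \<and>
     (\<exists>K. \<forall>x\<in>carrier H. hnorm H (T x) \<le> K * hnorm H x)"

definition op_norm :: "'a inner_space \<Rightarrow> ('a \<Rightarrow> 'a) \<Rightarrow> real" where
  "op_norm H T = (SUP x\<in>{x \<in> carrier H. hnorm H x \<le> 1}. hnorm H (T x))"

definition invertible_operator :: "'a inner_space \<Rightarrow> ('a \<Rightarrow> 'a) \<Rightarrow> bool" where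
  "invertible_operator H T \<longleftrightarrow> bounded_operator H T \<and>
     (\<exists>S. bounded_operator H S \<and> (\<forall>x\<in>carrier H. S (T x) = x \<and> T (S x) = x))"

definition op_inverse :: "'a inner_space \<Rightarrow> ('a \<Rightarrow> 'a) \<Rightarrow> 'a \<Rightarrow> 'a" where
  "op_inverse H T = inv_into (carrier H) T"

definition spectrum :: "'a inner_space \<Rightarrow> ('a \<Rightarrow> 'a) \<Rightarrow> complex set" where
  "spectrum H T = {z. \<not> invertible_operator H (\<lambda>x. T x \<ominus>\<^bsub>H\<^esub> z \<odot>\<^bsub>H\<^esub> x)}"

definition poly_op :: "'a inner_space \<Rightarrow> complex poly \<Rightarrow> ('a \<Rightarrow> 'a) \<Rightarrow> 'a \<Rightarrow> 'a" where
  "poly_op H p T x = (\<Oplus>\<^bsub>H\<^esub>i\<in>{..degree p}. coeff p i \<odot>\<^bsub>H\<^esub> (T ^^ i) x)"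

text \<open>
  A rational function is represented by a pair \<open>(p, q)\<close> standing for \<open>p / q\<close>.  The pair need not
  be in lowest terms; a rational function has its poles off \<open>X\<close> iff it has a representation whose
  denominator has no zero in \<open>X\<close>.
\<close>

definition Rat :: "complex set \<Rightarrow> (complex poly \<times> complex poly) set" where
  "Rat X = {(p, q). q \<noteq> 0 \<and> (\<forall>z\<in>X. poly q z \<noteq> 0)}"

definition rat_eval :: "complex poly \<times> complex poly \<Rightarrow> complex \<Rightarrow> complex" where
  "rat_eval f z = poly (fst f) z / poly (snd f) z"

definition rat_op ::
    "'a inner_space \<Rightarrow> complex poly \<times> complex poly \<Rightarrow> ('a \<Rightarrow> 'a) \<Rightarrow> 'a \<Rightarrow> 'a" where
  "rat_op H f T x = poly_op H (fst f) T (op_inverse H (poly_op H (snd f) T) x)"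

text \<open>The supremum over the empty set is \<open>0\<close>, as for any family of nonnegative quantities;
  the real \<^term>\<open>Sup {}\<close> is unspecified.\<close>

definition sup_norm :: "complex set \<Rightarrow> (complex \<Rightarrow> complex) \<Rightarrow> real" where
  "sup_norm X g = (if X = {} then 0 else SUP \<xi>\<in>X. cmod (g \<xi>))"

definition spectral_set :: "complex set \<Rightarrow> 'a inner_space \<Rightarrow> ('a \<Rightarrow> 'a) \<Rightarrow> bool" where
  "spectral_set X H T \<longleftrightarrow> compact X \<and> spectrum H T \<subseteq> X \<and>
     (\<forall>f\<in>Rat X. op_norm H (rat_op H f T) \<le> sup_norm X (rat_eval f))"

text \<open>A class of operators is a set of pairs of a Hilbert space and an operator on it.\<close>

type_synonym 'a op_class = "('a inner_space \<times> ('a \<Rightarrow> 'a)) set"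

definition minimal_spectral_set :: "complex set \<Rightarrow> 'a op_class \<Rightarrow> bool" where
  "minimal_spectral_set X \<T> \<longleftrightarrow> compact X \<and>
     (\<forall>(H, T)\<in>\<T>. spectral_set X H T) \<and>
     (\<forall>X'. compact X' \<and> X' \<subset> X \<longrightarrow> (\<exists>(H, T)\<in>\<T>. \<not> spectral_set X' H T))"

definition C1 :: "real \<Rightarrow> 'a op_class" where
  "C1 r = {(H, T). complex_hilbert_space H \<and> invertible_operator H T \<and>
     op_norm H T \<le> 1 \<and>
     op_norm H (\<lambda>x. complex_of_real r \<odot>\<^bsub>H\<^esub> op_inverse H T x) \<le> 1}"

end

(*
The disc is spectral for every contraction T by von Neumann's inequality.  For a polynomial f it
is read off from the sesquilinear form <p(T)x, q(T)x> on polynomials: its defect form D is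
positive, for strict contractions the form is the sum of the D(X^m p, X^m q), and multiplication
by f is bounded on that sum by a discrete Parseval identity over roots of unity.  A rational
function is handled through polynomial approximations s of 1/q, for which
p(T) x = (ps)(T) q(T) x + (p(1 - sq))(T) x.

For minimality let z0 be a point of the disc outside X'.  If r <= |z0|, the operator z0 I lies in
C_{1,r} and its spectrum is not contained in X'.  If |z0| < r, put a = sqrt r and
T = [[a, 1 - r], [0, a]] on C^2; both T and r T^{-1} have norm 1, and |(1 - r) f'(a)| <= ||f(T)|| whenever f(a) = 0.  Choose
f = b (1 + t h) with b the Blaschke factor at a, h = c w - cnj c / w, w the Blaschke factor at z0,
c = - cnj (w a) and t > 0 small.  On the unit circle Re h = 0, so |f|^2 <= 1 + O(t^2) there, and
inside the disc the loss 1 - |b|^2 dominates the gain 2 t Re h, both being controlled by 1 - |z|^2.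
But (1 - r) f'(a) = 1 + t (1 - |w a|^2), which exceeds this bound for small t.
*)
theory Submission
  imports Defs "HOL-Computational_Algebra.Fundamental_Theorem_Algebra" "HOL-Number_Theory.Cong"
begin

section \<open>Positive sesquilinear forms on polynomials\<close>

lemma poly_smult_sum_right:
  "Polynomial.smult c (\<Sum>i\<in>A. f i) = (\<Sum>i\<in>A. Polynomial.smult c (f i))"
  by (induction A rule: infinite_finite_induct) (simp_all add: smult_add_right)

text \<open>The product \<open>cnj (w m) * w n\<close> is a \<open>P\<close>-th root of unity, equal
  to 1 only for \<open>m = n\<close>, so the sum is geometric and otherwise vanishes.\<close>

lemma sum_roots_unity_orthogonal:
  fixes P :: nat
  assumes "m < P" "n < P"
  defines "w \<equiv> \<lambda>k. cis (2 * pi * real k / real P)"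
  shows "(\<Sum>j<P. cnj (w j ^ m) * w j ^ n) = (if m = n then of_nat P else 0)"
proof -
  have P: "P > 0" using assms by simp
  \<comment> \<open>Swapping index and exponent turns the sum over \<open>j\<close> into powers of
    one fixed number.\<close>
  have sym: "w j ^ m = w m ^ j" for j m
    by (simp add: w_def Complex.DeMoivre mult_ac)
  have unit: "cnj (w k) * w k = 1" for k
    by (simp add: w_def cis_cnj cis_mult)
  have pow: "w k ^ P = 1" if "k < P" for k
    using Complex.bij_betw_roots_unity[OF P] that unfolding w_def bij_betw_def by auto
  have eq: "w m = w n \<longleftrightarrow> m = n"
    using inj_on_eq_iff[OF bij_betw_imp_inj_on[OF Complex.bij_betw_roots_unity[OF P]], of m n] assms(1,2)
    by (simp only: w_def lessThan_iff)
  define z where "z = cnj (w m) * w n"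
  have "(\<Sum>j<P. cnj (w j ^ m) * w j ^ n) = (\<Sum>j<P. z ^ j)"
    by (intro sum.cong refl) (simp only: sym[of _ m] sym[of _ n] z_def power_mult_distrib complex_cnj_power)
  also have "\<dots> = (if m = n then of_nat P else 0)"
  proof (cases "m = n")
    case True
    then show ?thesis by (simp add: z_def unit)
  next
    case False
    have "z \<noteq> 1"
    proof
      assume "z = 1"
      have "w n = w m * z"
        using unit[of m] by (simp add: z_def mult.assoc[symmetric] mult.commute[of "w m"])
      then have "w n = w m" using \<open>z = 1\<close> by simp
      then show False using eq False by simp
    qed
    moreover have "z ^ P = 1"
      using pow assms by (simp add: z_def power_mult_distrib flip: complex_cnj_power)
    ultimately show ?thesis using False by (simp add: geometric_sum)
  qed
  finally show ?thesis .
qed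

text \<open>Only semidefiniteness is asked: the intended form, the inner product of
  \<open>p(T) x\<close> and \<open>q(T) x\<close>, degenerates as soon as some nonzero
  \<open>p\<close> has \<open>p(T) x = 0\<close>.\<close>

locale psd_form =
  fixes B :: "complex poly \<Rightarrow> complex poly \<Rightarrow> complex"
  assumes add_left: "B (p + q) s = B p s + B q s"
    and smult_left: "B (Polynomial.smult c p) s = c * B p s"
    and herm: "B q p = cnj (B p q)"
    and nonneg: "0 \<le> Re (B p p)"
begin

lemma add_right: "B s (p + q) = B s p + B s q"
  using herm[of s "p + q"] herm[of s p] herm[of s q] by (simp add: add_left)

lemma smult_right: "B s (Polynomial.smult c p) = cnj c * B s p"
  using herm[of s "Polynomial.smult c p"] herm[of s p] by (simp add: smult_left)

lemma zero_left: "B 0 s = 0"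
  using smult_left[of 0 0 s] by simp

lemma zero_right: "B s 0 = 0"
  using smult_right[of s 0 0] by simp

lemma sum_left: "B (sum f A) s = (\<Sum>i\<in>A. B (f i) s)"
  by (induction A rule: infinite_finite_induct) (simp_all add: zero_left add_left)

lemma sum_right: "B s (sum f A) = (\<Sum>i\<in>A. B s (f i))"
  by (induction A rule: infinite_finite_induct) (simp_all add: zero_right add_right)

text \<open>After expanding both arguments, orthogonality of the characters
  \<open>j |-> w j ^ m\<close> removes every mixed term.\<close>

lemma parseval:
  fixes P :: nat
  defines "w \<equiv> \<lambda>k. cis (2 * pi * real k / real P)"
  shows "(\<Sum>j<P. B (\<Sum>m<P. Polynomial.smult (cnj (w j ^ m)) (y m)) (\<Sum>m<P. Polynomial.smult (cnj (w j ^ m)) (y m)))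
    = of_nat P * (\<Sum>m<P. B (y m) (y m))"
proof -
  have "(\<Sum>j<P. B (\<Sum>m<P. Polynomial.smult (cnj (w j ^ m)) (y m)) (\<Sum>m<P. Polynomial.smult (cnj (w j ^ m)) (y m)))
    = (\<Sum>j<P. \<Sum>n<P. \<Sum>m<P. B (y m) (y n) * (cnj (w j ^ m) * w j ^ n))"
    by (simp add: sum_left sum_right smult_left smult_right sum_distrib_left sum_distrib_right mult_ac)
  also have "\<dots> = (\<Sum>n<P. \<Sum>m<P. \<Sum>j<P. B (y m) (y n) * (cnj (w j ^ m) * w j ^ n))"
    by (subst sum.swap, rule sum.cong[OF refl], rule sum.swap)
  also have "\<dots> = (\<Sum>n<P. \<Sum>m<P. if m = n then B (y m) (y n) * of_nat P else 0)"
    unfolding sum_distrib_left[symmetric] w_def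
    by (intro sum.cong refl, subst sum_roots_unity_orthogonal) auto
  also have "\<dots> = of_nat P * (\<Sum>m<P. B (y m) (y m))"
    by (simp add: sum_distrib_left mult.commute)
  finally show ?thesis .
qed

end

text \<open>A finite section of the multiplication by \<open>f\<close> on sequences of vectors, to
  be applied to the defect form of a contraction. It is compared with a circulant matrix, whose
  eigenvalues are values of \<open>f\<close> on the unit circle.\<close>

lemma (in psd_form) toeplitz_bound:
  assumes M: "\<And>z. cmod z = 1 \<Longrightarrow> cmod (poly f z) \<le> M" and dN: "degree f \<le> N"
  shows "(\<Sum>m<N - degree f. Re (B (monom 1 m * (f * p)) (monom 1 m * (f * p))))
    \<le> M\<^sup>2 * (\<Sum>m<N. Re (B (monom 1 m * p) (monom 1 m * p)))"
proof (cases "N = 0")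
  case False
  define w where "w = (\<lambda>k. cis (2 * pi * real k / real N))"
  define v where "v = (\<lambda>k. monom 1 k * p)"
  \<comment> \<open>Indices are taken modulo \<open>N\<close>, which makes multiplication by \<open>f\<close> diagonal in the discrete Fourier
    basis \<open>g\<close>; no index below \<open>N - degree f\<close> wraps around.\<close>
  define y where "y = (\<lambda>m. \<Sum>i\<le>degree f. Polynomial.smult (coeff f i) (v ((m + i) mod N)))"
  define g where "g = (\<lambda>j. \<Sum>k<N. Polynomial.smult (cnj (w j ^ k)) (v k))"
  have N0: "N > 0" using False by simp
  have unit: "cnj (w k) * w k = 1" for k
    by (simp add: w_def cis_cnj cis_mult)
  have pow: "w k ^ N = 1" if "k < N" for k
    using Complex.bij_betw_roots_unity[OF N0] that unfolding w_def bij_betw_def by auto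
  have bij: "bij_betw (\<lambda>m. (m + i) mod N) {..<N} {..<N}" for i
  proof -
    have "inj_on (\<lambda>m. (m + i) mod N) {..<N}"
    proof (rule inj_onI)
      fix a b assume "a \<in> {..<N}" "b \<in> {..<N}" "(a + i) mod N = (b + i) mod N"
      then have "[a = b] (mod N)" using cong_add_rcancel_nat[of a i b N] by (simp add: cong_def)
      with \<open>a \<in> _\<close> \<open>b \<in> _\<close> show "a = b" by (simp add: cong_def)
    qed
    moreover have "(\<lambda>m. (m + i) mod N) ` {..<N} \<subseteq> {..<N}" using N0 by auto
    ultimately show ?thesis by (simp add: bij_betw_def endo_inj_surj)
  qed
  \<comment> \<open>Since \<open>w j ^ N = 1\<close>, exponents of \<open>w j\<close> may be reduced
    modulo \<open>N\<close>.\<close>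
  have cnjpow: "cnj (w j ^ m) = w j ^ i * cnj (w j ^ ((m + i) mod N))" if "j < N" for j m i
  proof -
    have "w j ^ (m + i) = w j ^ (N * ((m + i) div N) + (m + i) mod N)" by simp
    also have "\<dots> = w j ^ ((m + i) mod N)"
      using pow[OF that] by (simp only: power_add power_mult) simp
    finally have "w j ^ i * cnj (w j ^ ((m + i) mod N)) = w j ^ i * cnj (w j ^ (m + i))" by simp
    also have "\<dots> = (cnj (w j) * w j) ^ i * cnj (w j ^ m)"
      by (simp only: power_add power_mult_distrib complex_cnj_power complex_cnj_mult mult_ac)
    finally show ?thesis by (simp add: unit)
  qed
  \<comment> \<open>In Fourier coordinates the circulant acts as the scalar
    \<open>poly f (w j)\<close>, which is where the bound on the unit circle enters.\<close>
  have y_sum: "(\<Sum>m<N. Polynomial.smult (cnj (w j ^ m)) (y m)) = Polynomial.smult (poly f (w j)) (g j)" if "j < N" for j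
  proof -
    have "(\<Sum>m<N. Polynomial.smult (cnj (w j ^ m)) (y m))
      = (\<Sum>i\<le>degree f. \<Sum>m<N. Polynomial.smult (coeff f i * cnj (w j ^ m)) (v ((m + i) mod N)))"
      unfolding y_def poly_smult_sum_right by (subst sum.swap) (simp add: mult_ac)
    also have "\<dots> = (\<Sum>i\<le>degree f. \<Sum>m<N. Polynomial.smult (coeff f i * w j ^ i)
        (Polynomial.smult (cnj (w j ^ ((m + i) mod N))) (v ((m + i) mod N))))"
      by (intro sum.cong refl, subst cnjpow[OF that]) (simp add: mult_ac)
    also have "\<dots> = (\<Sum>i\<le>degree f. Polynomial.smult (coeff f i * w j ^ i) (g j))"
      unfolding poly_smult_sum_right[symmetric] g_def
      by (intro sum.cong refl arg_cong2[where f = Polynomial.smult] sum.reindex_bij_betw[OF bij])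
    also have "\<dots> = Polynomial.smult (poly f (w j)) (g j)"
      by (simp add: poly_altdef smult_sum)
    finally show ?thesis .
  qed
  have y_low: "y m = monom 1 m * (f * p)" if "m < N - degree f" for m
  proof -
    have "y m = (\<Sum>i\<le>degree f. monom 1 m * (monom (coeff f i) i * p))"
      unfolding y_def v_def
      by (intro sum.cong refl) (use that in \<open>simp add: mult_monom smult_monom flip: mult_smult_left mult.assoc\<close>)
    also have "\<dots> = monom 1 m * ((\<Sum>i\<le>degree f. monom (coeff f i) i) * p)"
      by (simp add: sum_distrib_left sum_distrib_right)
    finally show ?thesis by (simp add: poly_as_sum_of_monoms)
  qed
  let ?Q = "\<lambda>p. Re (B p p)"
  have pars: "(\<Sum>j<N. ?Q (\<Sum>m<N. Polynomial.smult (cnj (w j ^ m)) (u m))) = real N * (\<Sum>m<N. ?Q (u m))" for u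
    using arg_cong[OF parseval[where P = N and y = u], of Re] unfolding w_def
    by (simp only: Re_sum) simp
  have Qsm: "?Q (Polynomial.smult c u) = (cmod c)\<^sup>2 * ?Q u" for c u
  proof -
    have "B (Polynomial.smult c u) (Polynomial.smult c u) = complex_of_real ((cmod c)\<^sup>2) * B u u"
      by (simp add: smult_left smult_right complex_norm_square mult.assoc flip: of_real_power)
    then show ?thesis by simp
  qed
  have "real N * (\<Sum>m<N. ?Q (y m)) = (\<Sum>j<N. ?Q (Polynomial.smult (poly f (w j)) (g j)))"
    unfolding pars[symmetric] by (intro sum.cong refl) (simp only: y_sum lessThan_iff)
  also have "\<dots> \<le> (\<Sum>j<N. M\<^sup>2 * ?Q (g j))"
    unfolding Qsm by (intro sum_mono mult_right_mono power_mono M nonneg) (simp_all add: w_def)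
  also have "\<dots> = real N * (M\<^sup>2 * (\<Sum>m<N. ?Q (v m)))"
    unfolding sum_distrib_left[symmetric] g_def pars by simp
  finally have "(\<Sum>m<N. ?Q (y m)) \<le> M\<^sup>2 * (\<Sum>m<N. ?Q (v m))"
    using N0 by simp
  \<comment> \<open>The indices that may wrap around are dropped; their terms are
    nonnegative.\<close>
  moreover have "(\<Sum>m<N - degree f. ?Q (y m)) \<le> (\<Sum>m<N. ?Q (y m))"
    by (rule sum_mono2) (auto simp: nonneg)
  moreover have "(\<Sum>m<N - degree f. ?Q (y m)) = (\<Sum>m<N - degree f. ?Q (monom 1 m * (f * p)))"
    by (intro sum.cong refl) (simp only: y_low lessThan_iff)
  ultimately show ?thesis unfolding v_def by linarith
qed simp

text \<open>For the defect form, both sums in \<open>toeplitz_bound\<close> telescope to the claim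
  up to remainders; the strictness \<open>\<rho> < 1\<close> makes the remainder of
  \<open>f * p\<close> decay geometrically.\<close>

lemma (in psd_form) strict_contraction_bound:
  assumes rho: "0 \<le> \<rho>" "\<rho> < 1"
    and contr: "\<And>p. Re (B (pCons 0 p) (pCons 0 p)) \<le> \<rho>\<^sup>2 * Re (B p p)"
    and M: "\<And>z. cmod z = 1 \<Longrightarrow> cmod (poly f z) \<le> M"
  shows "Re (B (f * p) (f * p)) \<le> M\<^sup>2 * Re (B p p)"
proof -
  let ?Q = "\<lambda>p. Re (B p p)"
  \<comment> \<open>The defect form; the form \<open>B\<close> telescopes into its shifts.\<close>
  define D where "D = (\<lambda>p q. B p q - B (pCons 0 p) (pCons 0 q))"
  have rho2: "\<rho>\<^sup>2 < 1" "0 \<le> \<rho>\<^sup>2" using rho by (simp_all add: power_less_one_iff abs_square_less_1)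
  have pCadd: "pCons 0 (p + q) = pCons 0 p + pCons 0 q" for p q :: "complex poly" by simp
  have pCsm: "pCons 0 (Polynomial.smult c p) = Polynomial.smult c (pCons 0 p)" for c and p :: "complex poly"
    by simp
  interpret D: psd_form D
  proof
    show "0 \<le> Re (D p p)" for p
      using contr[of p] mult_right_mono[OF less_imp_le[OF rho2(1)] nonneg[of p]] by (simp add: D_def)
    show "D q p = cnj (D p q)" for p q
      using herm[of q p] herm[of "pCons 0 q" "pCons 0 p"] by (simp add: D_def)
  qed (simp_all only: D_def pCadd pCsm add_left smult_left algebra_simps)
  define E where "E = (\<lambda>u m. ?Q (monom 1 m * u))"
  have shift: "monom 1 (Suc m) * u = pCons 0 (monom 1 m * u)" for m and u :: "complex poly"
    by (simp add: monom_Suc)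
  have tele: "(\<Sum>m<n. Re (D (monom 1 m * u) (monom 1 m * u))) = ?Q u - E u n" for n u
    by (induction n) (simp_all add: D_def E_def shift)
  have Edec: "E u n \<le> (\<rho>\<^sup>2) ^ n * ?Q u" for u n
  proof (induction n)
    case (Suc n)
    have "E u (Suc n) \<le> \<rho>\<^sup>2 * E u n" unfolding E_def shift by (rule contr)
    also have "\<dots> \<le> \<rho>\<^sup>2 * ((\<rho>\<^sup>2) ^ n * ?Q u)" using Suc.IH rho2(2) by (rule mult_left_mono)
    finally show ?case by (simp add: mult_ac)
  qed (simp add: E_def)
  have "?Q (f * p) - (\<rho>\<^sup>2) ^ n * ?Q (f * p) \<le> M\<^sup>2 * ?Q p" for n
  proof -
    \<comment> \<open>With \<open>N = n + degree f\<close> the shortened left sum has exactly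
      \<open>n\<close> terms.\<close>
    have "?Q (f * p) - E (f * p) n \<le> M\<^sup>2 * (?Q p - E p (n + degree f))"
      using D.toeplitz_bound[of f M "n + degree f" p] M unfolding tele by simp
    also have "\<dots> \<le> M\<^sup>2 * ?Q p"
      by (rule mult_left_mono) (simp_all add: E_def nonneg)
    finally show ?thesis using Edec[of "f * p" n] by linarith
  qed
  moreover have "(\<lambda>n. ?Q (f * p) - (\<rho>\<^sup>2) ^ n * ?Q (f * p)) \<longlonglongrightarrow> ?Q (f * p) - 0 * ?Q (f * p)"
    by (intro tendsto_intros LIMSEQ_realpow_zero rho2)
  ultimately show ?thesis
    by (intro LIMSEQ_le_const2[where X = "\<lambda>n. ?Q (f * p) - (\<rho>\<^sup>2) ^ n * ?Q (f * p)"]) auto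
qed

text \<open>The form \<open>B (sc \<rho> p) (sc \<rho> q)\<close> belongs to \<open>\<rho> T\<close>
  in place of \<open>T\<close>, so \<open>f\<close> and its bound \<open>M\<close> stay fixed while
  \<rho> tends to 1.\<close>

lemma (in psd_form) contraction_bound:
  assumes contr: "\<And>p. Re (B (pCons 0 p) (pCons 0 p)) \<le> Re (B p p)"
    and M: "\<And>z. cmod z = 1 \<Longrightarrow> cmod (poly f z) \<le> M"
  shows "Re (B f f) \<le> M\<^sup>2 * Re (B 1 1)"
proof -
  \<comment> \<open>Rescaling the variable by \<open>\<rho> < 1\<close> makes the contraction strict.\<close>
  define sc where "sc = (\<lambda>(\<rho>::real) p. pcompose p [:0, complex_of_real \<rho>:])"
  have sc_expand: "sc \<rho> f = (\<Sum>i\<le>degree f. Polynomial.smult (of_real \<rho> ^ i) (monom (coeff f i) i))" for \<rho>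
  proof -
    have lin: "[:0, of_real \<rho>:] ^ i = Polynomial.smult (of_real \<rho> ^ i) ([:0, 1:] ^ i)" for i
      using smult_power[of "of_real \<rho>" "[:0, 1:]" i] by simp
    show ?thesis
      by (simp add: sc_def pcompose_altdef poly_altdef coeff_map_poly degree_map_poly lin monom_altdef mult.commute)
  qed
  have bound: "Re (B (sc \<rho> f) (sc \<rho> f)) \<le> M\<^sup>2 * Re (B 1 1)" if "0 \<le> \<rho>" "\<rho> < 1" for \<rho>
  proof -
    interpret S: psd_form "\<lambda>p q. B (sc \<rho> p) (sc \<rho> q)"
      by standard (simp_all add: sc_def pcompose_add pcompose_smult add_left smult_left nonneg, rule herm)
    have "Re (B (sc \<rho> (pCons 0 p)) (sc \<rho> (pCons 0 p))) \<le> \<rho>\<^sup>2 * Re (B (sc \<rho> p) (sc \<rho> p))" for p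
    proof -
      have "sc \<rho> (pCons 0 p) = Polynomial.smult (of_real \<rho>) (pCons 0 (sc \<rho> p))"
        by (simp add: sc_def pcompose_pCons)
      then have "B (sc \<rho> (pCons 0 p)) (sc \<rho> (pCons 0 p)) = of_real (\<rho>\<^sup>2) * B (pCons 0 (sc \<rho> p)) (pCons 0 (sc \<rho> p))"
        by (simp only: smult_left smult_right) (simp add: power2_eq_square)
      then show ?thesis using contr[of "sc \<rho> p"] by (simp add: mult_left_mono)
    qed
    from S.strict_contraction_bound[OF that this M, of 1] show ?thesis by (simp add: sc_def pcompose_1)
  qed
  \<comment> \<open>Expanded in coefficients of \<open>f\<close>, the value is a polynomial in
    \<rho>, hence continuous.\<close>
  have cont: "(\<lambda>n. Re (B (sc (\<rho> n) f) (sc (\<rho> n) f))) \<longlonglongrightarrow> Re (B (sc 1 f) (sc 1 f))" if "\<rho> \<longlonglongrightarrow> 1" for \<rho>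
    unfolding sc_expand sum_left sum_right smult_left smult_right by (intro tendsto_intros that)
  have "(\<lambda>n. 1 - 1 / real (Suc n)) \<longlonglongrightarrow> 1 - 0"
    by (intro tendsto_intros LIMSEQ_Suc lim_1_over_n)
  then have "(\<lambda>n. Re (B (sc (1 - 1 / real (Suc n)) f) (sc (1 - 1 / real (Suc n)) f))) \<longlonglongrightarrow> Re (B (sc 1 f) (sc 1 f))"
    by (intro cont) simp
  then have "Re (B (sc 1 f) (sc 1 f)) \<le> M\<^sup>2 * Re (B 1 1)"
    by (rule LIMSEQ_le_const2) (auto intro!: bound exI[of _ 0])
  then show ?thesis by (simp add: sc_def pcompose_idR)
qed

section \<open>Approximating reciprocals of polynomials on the disc\<close>

text \<open>Induction over linear factors: each root \<open>a\<close> has modulus above 1, so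
  \<open>1 / (a - z)\<close> is a uniform limit on the disc of partial sums of its Taylor series at
  0.\<close>

lemma poly_reciprocal_approx:
  fixes q :: "complex poly"
  assumes "\<forall>z\<in>cball 0 1. poly q z \<noteq> 0" and "\<epsilon> > 0"
  shows "\<exists>s. \<forall>z\<in>cball 0 1. cmod (poly (s * q) z - 1) \<le> \<epsilon>"
  using assms
proof (induction q arbitrary: \<epsilon> rule: poly_root_induct[where P = "\<lambda>_. True"])
  case 0
  then show ?case by auto
next
  case (no_roots p)
  then have "constant (poly p)" using fundamental_theorem_of_algebra by blast
  then obtain c where c: "p = [:c:]" using constant_degree degree_eq_zeroE by metis
  then have "c \<noteq> 0" using no_roots(2)[rule_format, of 0] by auto
  then show ?case using no_roots by (intro exI[of _ "[:1/c:]"]) (simp add: c)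
next
  case (root a p)
  have a: "cmod a > 1"
  proof (rule ccontr)
    assume "\<not> cmod a > 1"
    then show False using root(3) by (auto simp: dist_norm)
  qed
  \<comment> \<open>The relative errors \<open>u\<close> and \<open>v\<close> of the two factors
    combine to \<open>u + v + u * v\<close>, which is at most \<open>3 * \<delta>\<close> once
    \<delta> is at most 1.\<close>
  define \<delta> where "\<delta> = min 1 (\<epsilon> / 3)"
  have \<delta>: "0 < \<delta>" "\<delta> \<le> 1" "3 * \<delta> \<le> \<epsilon>" using root(4) by (auto simp: \<delta>_def)
  have "\<forall>z\<in>cball 0 1. poly p z \<noteq> 0" using root(3) by auto
  from root(2)[OF this \<delta>(1)] obtain s where s: "\<And>z. z \<in> cball 0 1 \<Longrightarrow> cmod (poly (s * p) z - 1) \<le> \<delta>"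
    by blast
  have "(\<lambda>n. (1 / cmod a) ^ n) \<longlonglongrightarrow> 0" using a by (intro LIMSEQ_realpow_zero) (simp_all add: divide_less_eq)
  then have "\<forall>\<^sub>F n in sequentially. (1 / cmod a) ^ n < \<delta>" using \<delta>(1) by (rule order_tendstoD)
  then obtain n where n: "(1 / cmod a) ^ n < \<delta>" by (auto simp: eventually_sequentially)
  \<comment> \<open>The first \<open>n\<close> terms of the geometric series of
    \<open>1 / (a - z)\<close>.\<close>
  define t where "t = (\<Sum>k<n. monom (1 / a ^ Suc k) k)"
  have t: "poly t z * (a - z) - 1 = - ((z / a) ^ n)" for z
  proof -
    have a0: "a \<noteq> 0" using a by auto
    have summand: "poly (monom (1 / a ^ Suc k) k) z * (a - z) = (1 - z / a) * (z / a) ^ k" for k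
      using a0 by (simp add: poly_monom power_divide) (simp add: field_simps)
    have "poly t z * (a - z) = (1 - z / a) * (\<Sum>k<n. (z / a) ^ k)"
      unfolding t_def poly_sum sum_distrib_right summand sum_distrib_left ..
    also have "\<dots> = 1 - (z / a) ^ n" by (rule one_diff_power_eq[symmetric])
    finally show ?thesis by simp
  qed
  have "cmod (poly (s * t * ([:a, -1:] * p)) z - 1) \<le> \<epsilon>" if z: "z \<in> cball 0 1" for z
  proof -
    define u v where "u = poly (s * p) z - 1" and "v = poly t z * (a - z) - 1"
    have u: "cmod u \<le> \<delta>" using s z by (simp add: u_def)
    have "cmod v = (cmod z / cmod a) ^ n" unfolding v_def t by (simp add: norm_power norm_divide)
    also have "\<dots> \<le> (1 / cmod a) ^ n" using z a by (intro power_mono divide_right_mono) auto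
    finally have v: "cmod v \<le> \<delta>" using n by simp
    have "poly (s * t * ([:a, -1:] * p)) z - 1 = u + v + u * v"
      by (simp add: u_def v_def algebra_simps)
    then have "cmod (poly (s * t * ([:a, -1:] * p)) z - 1) \<le> cmod u + cmod v + cmod u * cmod v"
      using norm_triangle_ineq[of "u + v" "u * v"] norm_triangle_ineq[of u v] by (simp add: norm_mult)
    also have "\<dots> \<le> \<delta> + \<delta> + 1 * \<delta>" using u v \<delta> by (intro add_mono mult_mono) auto
    finally show ?thesis using \<delta> by linarith
  qed
  then show ?case by blast
qed

section \<open>Polynomials in a contraction\<close>

lemma complex_ring_simps [simp]:
  "carrier complex_ring = UNIV" "a \<otimes>\<^bsub>complex_ring\<^esub> b = a * b" "\<one>\<^bsub>complex_ring\<^esub> = 1"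
  "\<zero>\<^bsub>complex_ring\<^esub> = 0" "a \<oplus>\<^bsub>complex_ring\<^esub> b = a + b"
  by (simp_all add: complex_ring_def)

section \<open>Vector arithmetic and norm in a Hilbert space\<close>

context complex_hilbert_space
begin

lemma scale_closed [simp]: "x \<in> carrier H \<Longrightarrow> c \<odot> x \<in> carrier H"
  using smult_closed[of c x] by simp

lemma scale_add_left: "x \<in> carrier H \<Longrightarrow> (a + b) \<odot> x = a \<odot> x \<oplus> b \<odot> x"
  using smult_l_distr[of a b x] by simp

lemma scale_add_right: "x \<in> carrier H \<Longrightarrow> y \<in> carrier H \<Longrightarrow> a \<odot> (x \<oplus> y) = a \<odot> x \<oplus> a \<odot> y"
  using smult_r_distr[of a x y] by simp

lemma scale_scale: "x \<in> carrier H \<Longrightarrow> (a * b) \<odot> x = a \<odot> (b \<odot> x)"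
  using smult_assoc1[of a b x] by simp

lemma scale_one [simp]: "x \<in> carrier H \<Longrightarrow> 1 \<odot> x = x"
  using smult_one[of x] by simp

lemma scale_zero_left [simp]: "x \<in> carrier H \<Longrightarrow> 0 \<odot> x = \<zero>"
  using smult_l_null[of x] by simp

lemma scale_zero_right [simp]: "a \<odot> \<zero> = \<zero>"
  using smult_r_null[of a] by simp

lemma minus_scale: "x \<in> carrier H \<Longrightarrow> y \<in> carrier H \<Longrightarrow> x \<ominus> y = x \<oplus> (-1) \<odot> y"
proof -
  assume x: "x \<in> carrier H" and y: "y \<in> carrier H"
  have "(-1) \<odot> y \<oplus> y = \<zero>"
    using scale_add_left[OF y, of "-1" 1] y by simp
  then have "(-1) \<odot> y = \<ominus> y" using y by (simp add: M.minus_equality)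
  then show ?thesis by (simp add: M.minus_eq)
qed

lemma cinner_add_right:
  "\<lbrakk>x \<in> carrier H; y \<in> carrier H; z \<in> carrier H\<rbrakk> \<Longrightarrow> cinner H z (x \<oplus> y) = cinner H z x + cinner H z y"
  using cinner_commute[of "x \<oplus> y" z] cinner_commute[of x z] cinner_commute[of y z]
  by (simp add: cinner_add_left)

lemma cinner_scale_right:
  "\<lbrakk>x \<in> carrier H; y \<in> carrier H\<rbrakk> \<Longrightarrow> cinner H x (c \<odot> y) = cnj c * cinner H x y"
  using cinner_commute[of "c \<odot> y" x] cinner_commute[of y x]
  by (simp add: cinner_smult_left)

lemma cinner_zero_left [simp]: "x \<in> carrier H \<Longrightarrow> cinner H \<zero> x = 0"
  using cinner_smult_left[of \<zero> x 0] by simp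

lemma hnorm_nonneg [simp]: "x \<in> carrier H \<Longrightarrow> 0 \<le> hnorm H x"
  by (simp add: hnorm_def cinner_ge_zero)

lemma hnorm_square: "x \<in> carrier H \<Longrightarrow> (hnorm H x)\<^sup>2 = Re (cinner H x x)"
  by (simp add: hnorm_def cinner_ge_zero)

lemma cinner_self: "x \<in> carrier H \<Longrightarrow> cinner H x x = complex_of_real ((hnorm H x)\<^sup>2)"
  using cinner_commute[of x x] by (simp add: hnorm_square complex_eq_iff)

lemma hnorm_zero [simp]: "hnorm H \<zero> = 0"
  by (simp add: hnorm_def)

lemma hnorm_eq_zero: "x \<in> carrier H \<Longrightarrow> hnorm H x = 0 \<longleftrightarrow> x = \<zero>"
  using cinner_eq_zero[of x] cinner_self[of x] by auto

lemma hnorm_scale: "x \<in> carrier H \<Longrightarrow> hnorm H (c \<odot> x) = cmod c * hnorm H x"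
proof -
  assume x: "x \<in> carrier H"
  have "cinner H (c \<odot> x) (c \<odot> x) = complex_of_real ((cmod c * hnorm H x)\<^sup>2)"
    using x by (simp add: cinner_smult_left cinner_scale_right cinner_self[OF x] complex_norm_square[symmetric]
        power_mult_distrib mult.assoc[symmetric] mult.commute[of "cnj c"])
  then have "Re (cinner H (c \<odot> x) (c \<odot> x)) = (cmod c * hnorm H x)\<^sup>2"
    by (simp only: Re_complex_of_real)
  then show ?thesis using x by (simp add: hnorm_def[of H "c \<odot> x"])
qed

lemma cauchy_schwarz:
  assumes x: "x \<in> carrier H" and y: "y \<in> carrier H"
  shows "Re (cinner H x y) \<le> hnorm H x * hnorm H y"
proof (cases "hnorm H x = 0 \<or> hnorm H y = 0")
  case True
  then have "cinner H x y = 0"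
    using x y hnorm_eq_zero cinner_commute[of y x] by auto
  with x y show ?thesis by simp
next
  case False
  define a b where "a = hnorm H x" and "b = hnorm H y"
  have pos: "a * b > 0" using False x y hnorm_nonneg[of x] hnorm_nonneg[of y]
    by (simp add: a_def b_def less_le)
  \<comment> \<open>With \<open>a\<close> and \<open>b\<close> the norms of \<open>x\<close> and
    \<open>y\<close>, the vector \<open>b x - a y\<close> has squared norm
    \<open>2 a b (a b - Re <x, y>)\<close>.\<close>
  let ?u = "of_real b \<odot> x \<oplus> (- of_real a) \<odot> y"
  have "Re (cinner H ?u ?u) = 2 * (a * b) * (a * b - Re (cinner H x y))"
    using x y cinner_commute[of x y]
    by (simp add: cinner_add_left cinner_add_right cinner_smult_left cinner_scale_right cinner_self[OF x] cinner_self[OF y]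
        a_def[symmetric] b_def[symmetric]) (simp add: power2_eq_square algebra_simps)
  then have "0 \<le> (a * b) * (a * b - Re (cinner H x y))"
    using cinner_ge_zero[of ?u] x y by simp
  then show ?thesis using pos by (simp add: zero_le_mult_iff a_def b_def)
qed

lemma hnorm_triangle:
  assumes x: "x \<in> carrier H" and y: "y \<in> carrier H"
  shows "hnorm H (x \<oplus> y) \<le> hnorm H x + hnorm H y"
proof (rule power2_le_imp_le)
  have "(hnorm H (x \<oplus> y))\<^sup>2 = (hnorm H x)\<^sup>2 + 2 * Re (cinner H x y) + (hnorm H y)\<^sup>2"
    using x y cinner_commute[of x y]
    by (simp add: hnorm_square cinner_add_left cinner_add_right)
  also have "\<dots> \<le> (hnorm H x + hnorm H y)\<^sup>2"
    using cauchy_schwarz[OF x y] by (simp add: power2_sum)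
  finally show "(hnorm H (x \<oplus> y))\<^sup>2 \<le> (hnorm H x + hnorm H y)\<^sup>2" .
qed (use x y in simp)

lemma hnorm_minus_commute: "\<lbrakk>x \<in> carrier H; y \<in> carrier H\<rbrakk> \<Longrightarrow> hnorm H (x \<ominus> y) = hnorm H (y \<ominus> x)"
proof -
  assume x: "x \<in> carrier H" and y: "y \<in> carrier H"
  have "(-1) \<odot> (y \<ominus> x) = x \<ominus> y"
    using x y by (simp add: minus_scale scale_add_right M.a_comm scale_scale[symmetric])
  then show ?thesis using x y hnorm_scale[of "y \<ominus> x" "-1"] by simp
qed

lemma hnorm_triangle_minus:
  assumes "x \<in> carrier H" "y \<in> carrier H" "z \<in> carrier H"
  shows "hnorm H (x \<ominus> z) \<le> hnorm H (x \<ominus> y) + hnorm H (y \<ominus> z)"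
proof -
  have "(x \<ominus> y) \<oplus> (y \<ominus> z) = x \<oplus> (\<ominus> y \<oplus> y) \<oplus> \<ominus> z"
    using assms by (simp only: M.minus_eq M.a_assoc M.a_inv_closed M.a_closed M.add.m_closed)
  also have "\<dots> = x \<ominus> z" using assms by (simp add: M.minus_eq M.l_neg)
  finally show ?thesis using hnorm_triangle[of "x \<ominus> y" "y \<ominus> z"] assms by simp
qed

lemma hnorm_minus_eq_zero:
  assumes "x \<in> carrier H" "y \<in> carrier H" "hnorm H (x \<ominus> y) = 0"
  shows "x = y"
  using assms hnorm_eq_zero[of "x \<ominus> y"] M.minus_equality[of x "\<ominus> y"]
  by (simp add: M.minus_eq)

end

section \<open>Polynomial calculus of a bounded operator\<close>

locale hilbert_operator = complex_hilbert_space +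
  fixes T
  assumes bounded: "bounded_operator H T"
begin

lemma T_closed [simp]: "x \<in> carrier H \<Longrightarrow> T x \<in> carrier H"
  using bounded by (auto simp: bounded_operator_def)

lemma T_add: "\<lbrakk>x \<in> carrier H; y \<in> carrier H\<rbrakk> \<Longrightarrow> T (x \<oplus> y) = T x \<oplus> T y"
  using bounded by (auto simp: bounded_operator_def)

lemma T_scale: "x \<in> carrier H \<Longrightarrow> T (c \<odot> x) = c \<odot> T x"
  using bounded by (auto simp: bounded_operator_def)

lemma T_zero [simp]: "T \<zero> = \<zero>"
  using T_scale[of \<zero> 0] by simp

lemma T_pow_closed [simp]: "x \<in> carrier H \<Longrightarrow> (T ^^ i) x \<in> carrier H"
  by (induction i) auto

text \<open>Padding with zero coefficients lets polynomials of different degrees be summed over one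
  common range.\<close>

lemma poly_op_extend:
  assumes x: "x \<in> carrier H" and n: "degree p \<le> n"
  shows "poly_op H p T x = (\<Oplus>i\<in>{..n}. coeff p i \<odot> (T ^^ i) x)"
  using n
proof (induction n rule: dec_induct)
  case base
  show ?case by (simp add: poly_op_def)
next
  case (step n)
  then show ?case using x by (simp add: M.finsum_Suc Pi_def coeff_eq_0)
qed

lemma poly_op_closed [simp]: "x \<in> carrier H \<Longrightarrow> poly_op H p T x \<in> carrier H"
  unfolding poly_op_def by (rule M.finsum_closed) auto

lemma poly_op_zero [simp]: "x \<in> carrier H \<Longrightarrow> poly_op H 0 T x = \<zero>"
  by (simp add: poly_op_def M.finsum_0)

lemma poly_op_add:
  assumes x: "x \<in> carrier H"
  shows "poly_op H (p + q) T x = poly_op H p T x \<oplus> poly_op H q T x"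
proof -
  let ?n = "max (degree p) (degree q)"
  have "poly_op H (p + q) T x = (\<Oplus>i\<in>{..?n}. coeff p i \<odot> (T ^^ i) x \<oplus> coeff q i \<odot> (T ^^ i) x)"
    using x by (simp add: poly_op_extend[OF x degree_add_le_max] scale_add_left)
  also have "\<dots> = poly_op H p T x \<oplus> poly_op H q T x"
    using x by (simp add: poly_op_extend[OF x, of p ?n] poly_op_extend[OF x, of q ?n] M.finsum_addf Pi_def)
  finally show ?thesis .
qed

lemma poly_op_smult:
  assumes x: "x \<in> carrier H"
  shows "poly_op H (Polynomial.smult c p) T x = c \<odot> poly_op H p T x"
proof -
  have "poly_op H (Polynomial.smult c p) T x = (\<Oplus>i\<in>{..degree p}. c \<odot> (coeff p i \<odot> (T ^^ i) x))"
    using x by (simp add: poly_op_extend[OF x degree_smult_le] scale_scale)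
  also have "\<dots> = c \<odot> poly_op H p T x"
    using x finsum_smult_ldistr[of "{..degree p}" c "\<lambda>i. coeff p i \<odot> (T ^^ i) x"]
    by (simp add: poly_op_def Pi_def)
  finally show ?thesis .
qed

text \<open>Horner's scheme. It replaces the finite sums of \<open>poly_op\<close>, so that later
  identities follow by induction over \<open>pCons\<close>.\<close>

lemma poly_op_pCons:
  assumes x: "x \<in> carrier H"
  shows "poly_op H (pCons a p) T x = a \<odot> x \<oplus> T (poly_op H p T x)"
proof -
  have T_sum: "T (\<Oplus>i\<in>{..n}. coeff p i \<odot> (T ^^ i) x) = (\<Oplus>i\<in>{..n}. coeff p i \<odot> T ((T ^^ i) x))" for n
    by (induction n) (use x in \<open>simp_all add: M.finsum_0 M.finsum_Suc Pi_def T_add T_scale\<close>)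
  \<comment> \<open>For \<open>p = 0\<close> the degree does not grow, hence an inequality and the
    padded sum.\<close>
  have "degree (pCons a p) \<le> Suc (degree p)" by (simp add: degree_pCons_le)
  then have "poly_op H (pCons a p) T x = (\<Oplus>i\<in>{..Suc (degree p)}. coeff (pCons a p) i \<odot> (T ^^ i) x)"
    using x by (rule poly_op_extend[rotated])
  also have "\<dots> = (\<Oplus>i\<in>{..degree p}. coeff p i \<odot> T ((T ^^ i) x)) \<oplus> a \<odot> x"
    using x by (subst M.finsum_Suc2) (simp_all add: Pi_def)
  finally show ?thesis using x unfolding T_sum[symmetric] poly_op_def[symmetric]
    by (simp add: M.a_comm)
qed

lemma poly_op_one [simp]: "x \<in> carrier H \<Longrightarrow> poly_op H 1 T x = x"
  by (simp add: one_pCons poly_op_pCons)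

lemma poly_op_diff:
  "x \<in> carrier H \<Longrightarrow> poly_op H (p - q) T x = poly_op H p T x \<ominus> poly_op H q T x"
  using poly_op_add[of x p "Polynomial.smult (-1) q"] poly_op_smult[of x "-1" q]
  by (simp add: minus_scale)

lemma poly_op_add_arg:
  assumes x: "x \<in> carrier H" and y: "y \<in> carrier H"
  shows "poly_op H p T (x \<oplus> y) = poly_op H p T x \<oplus> poly_op H p T y"
proof (induction p)
  case (pCons a p)
  have *: "(A \<oplus> B) \<oplus> (C \<oplus> D) = (A \<oplus> C) \<oplus> (B \<oplus> D)"
    if "A \<in> carrier H" "B \<in> carrier H" "C \<in> carrier H" "D \<in> carrier H" for A B C D
    using that by (simp add: M.a_ac)
  show ?case using x y pCons.IH by (simp add: poly_op_pCons T_add scale_add_right *)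
qed (use x y in simp)

lemma poly_op_scale_arg:
  assumes x: "x \<in> carrier H"
  shows "poly_op H p T (c \<odot> x) = c \<odot> poly_op H p T x"
proof (induction p)
  case (pCons a p)
  then show ?case using x
    by (simp add: poly_op_pCons T_scale scale_add_right scale_scale[symmetric] mult.commute)
qed (use x in simp)

lemma poly_op_diff_arg:
  "\<lbrakk>x \<in> carrier H; y \<in> carrier H\<rbrakk> \<Longrightarrow> poly_op H p T (x \<ominus> y) = poly_op H p T x \<ominus> poly_op H p T y"
  by (simp add: minus_scale poly_op_add_arg poly_op_scale_arg)

lemma poly_op_mult:
  assumes x: "x \<in> carrier H"
  shows "poly_op H (p * q) T x = poly_op H p T (poly_op H q T x)"
proof (induction p)
  case (pCons a p)
  then show ?case using x
    by (simp add: poly_op_pCons poly_op_add poly_op_smult)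
qed (use x in simp)

end

section \<open>Von Neumann's inequality and invertible polynomials in a contraction\<close>

lemma poly_bounded_on_disc:
  fixes f :: "complex poly"
  obtains M where "0 \<le> M" "\<And>z. z \<in> cball 0 1 \<Longrightarrow> cmod (poly f z) \<le> M"
proof -
  have "compact (poly f ` cball 0 1)"
    by (intro compact_continuous_image continuous_intros compact_cball)
  then obtain M where M: "\<And>z. z \<in> cball 0 1 \<Longrightarrow> cmod (poly f z) \<le> M"
    using compact_imp_bounded bounded_iff by (metis imageI)
  then show ?thesis using that[of "max M 0"] by (meson le_max_iff_disj order_refl)
qed

locale hilbert_contraction = hilbert_operator +
  assumes contraction: "x \<in> carrier H \<Longrightarrow> hnorm H (T x) \<le> hnorm H x"
begin

text \<open>Under the form given by \<open>p(T) x\<close> and \<open>q(T) x\<close> the shift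
  \<open>pCons 0\<close> acts as \<open>T\<close>, so contractivity of \<open>T\<close> is the
  hypothesis of \<open>contraction_bound\<close>.\<close>

lemma von_neumann:
  assumes M: "\<And>z. cmod z = 1 \<Longrightarrow> cmod (poly f z) \<le> M" and x: "x \<in> carrier H"
  shows "hnorm H (poly_op H f T x) \<le> M * hnorm H x"
proof -
  interpret psd_form "\<lambda>p q. cinner H (poly_op H p T x) (poly_op H q T x)"
  proof
    show "cinner H (poly_op H q T x) (poly_op H p T x) = cnj (cinner H (poly_op H p T x) (poly_op H q T x))"
      for p q using x by (intro cinner_commute) auto
  qed (use x in \<open>simp_all add: poly_op_add poly_op_smult cinner_add_left cinner_smult_left cinner_ge_zero\<close>)
  have "(hnorm H (T (poly_op H p T x)))\<^sup>2 \<le> (hnorm H (poly_op H p T x))\<^sup>2" for p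
    using x contraction by (intro power_mono) auto
  then have "Re (cinner H (poly_op H f T x) (poly_op H f T x)) \<le> M\<^sup>2 * Re (cinner H (poly_op H 1 T x) (poly_op H 1 T x))"
    using x M by (intro contraction_bound) (simp_all add: poly_op_pCons hnorm_square)
  then have "(hnorm H (poly_op H f T x))\<^sup>2 \<le> (M * hnorm H x)\<^sup>2"
    using x by (simp add: hnorm_square power_mult_distrib)
  moreover have "0 \<le> M" using M[of 1] norm_ge_zero[of "poly f 1"] by (simp del: norm_ge_zero)
  ultimately show ?thesis using x by (auto intro: power2_le_imp_le)
qed

lemma bounded_poly_op: "bounded_operator H (poly_op H f T)"
proof -
  obtain M where "\<And>z. z \<in> cball 0 1 \<Longrightarrow> cmod (poly f z) \<le> M"
    using poly_bounded_on_disc[of f] by blast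
  then have "\<forall>x\<in>carrier H. hnorm H (poly_op H f T x) \<le> M * hnorm H x"
    by (auto intro!: von_neumann)
  then show ?thesis
    unfolding bounded_operator_def by (auto simp: poly_op_add_arg poly_op_scale_arg)
qed

text \<open>Stating the bound as \<open>|p| <= M |q|\<close> avoids the inverse of
  \<open>q(T)\<close>; the lemma can therefore help to show that this inverse exists.\<close>

lemma von_neumann_rational:
  assumes q: "\<forall>z\<in>cball 0 1. poly q z \<noteq> 0"
    and M: "0 \<le> M" "\<And>z. z \<in> cball 0 1 \<Longrightarrow> cmod (poly p z) \<le> M * cmod (poly q z)"
    and x: "x \<in> carrier H"
  shows "hnorm H (poly_op H p T x) \<le> M * hnorm H (poly_op H q T x)"
proof (rule field_le_epsilon)
  fix e :: real assume e: "e > 0"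
  obtain K where K: "0 \<le> K" "\<And>z. z \<in> cball 0 1 \<Longrightarrow> cmod (poly p z) \<le> K"
    using poly_bounded_on_disc[of p] by blast
  define b c where "b = hnorm H (poly_op H q T x)" and "c = hnorm H x"
  have bc: "0 \<le> M * b" "0 \<le> K * c" using x M(1) K(1) by (simp_all add: b_def c_def)
  \<comment> \<open>The total error will be \<open>\<epsilon> * (M * b + K * c)\<close>; the added 1
    keeps the denominator positive.\<close>
  define \<epsilon> where "\<epsilon> = e / (M * b + K * c + 1)"
  have \<epsilon>: "\<epsilon> > 0" using e bc by (simp add: \<epsilon>_def)
  obtain s where s: "\<And>z. z \<in> cball 0 1 \<Longrightarrow> cmod (poly (s * q) z - 1) \<le> \<epsilon>"
    using poly_reciprocal_approx[OF q \<epsilon>] by blast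
  have ps: "cmod (poly (p * s) z) \<le> M * (1 + \<epsilon>)" if z: "cmod z = 1" for z
  proof -
    have "cmod (poly (s * q) z) \<le> 1 + \<epsilon>"
      using norm_triangle_ineq[of "poly (s * q) z - 1" 1] s[of z] z by simp
    then have "M * cmod (poly (s * q) z) \<le> M * (1 + \<epsilon>)" using M(1) by (rule mult_left_mono)
    moreover have "cmod (poly (p * s) z) \<le> (M * cmod (poly q z)) * cmod (poly s z)"
      unfolding poly_mult norm_mult using z by (intro mult_right_mono M(2)) auto
    ultimately show ?thesis by (simp add: norm_mult mult_ac)
  qed
  have rest: "cmod (poly (p * (1 - s * q)) z) \<le> K * \<epsilon>" if z: "cmod z = 1" for z
    using s[of z] K z unfolding poly_mult[of p] norm_mult
    by (intro mult_mono) (auto simp: norm_minus_commute)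
  have split: "p = p * s * q + p * (1 - s * q)" by (simp add: algebra_simps)
  have "hnorm H (poly_op H p T x)
    \<le> hnorm H (poly_op H (p * s) T (poly_op H q T x)) + hnorm H (poly_op H (p * (1 - s * q)) T x)"
    by (subst split, subst poly_op_add[OF x], subst poly_op_mult[OF x, of "p * s" q],
        rule hnorm_triangle) (use x in auto)
  also have "\<dots> \<le> M * (1 + \<epsilon>) * b + K * \<epsilon> * c"
    unfolding b_def c_def by (intro add_mono von_neumann ps rest) (use x in auto)
  also have "\<dots> = M * b + \<epsilon> * (M * b + K * c)" by (simp add: algebra_simps)
  also have "\<dots> \<le> M * b + e"
    using e bc by (simp add: \<epsilon>_def divide_le_eq algebra_simps)
  finally show "hnorm H (poly_op H p T x) \<le> M * hnorm H (poly_op H q T x) + e" by (simp add: b_def)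
qed

text \<open>Neumann series. For \<open>s\<close> close to \<open>1 / q\<close> the polynomial
  \<open>e = 1 - s * q\<close> is at most 1/2 on the unit circle, so the partial sums of
  \<open>e ^ k\<close>, applied to \<open>y\<close>, converge to some \<open>z\<close> with
  \<open>q(T) (s(T) z) = y\<close>.\<close>

lemma poly_op_surj:
  assumes q: "\<forall>z\<in>cball 0 1. poly q z \<noteq> 0" and y: "y \<in> carrier H"
  obtains x where "x \<in> carrier H" "poly_op H q T x = y"
proof -
  obtain s where s: "\<And>z. z \<in> cball 0 1 \<Longrightarrow> cmod (poly (s * q) z - 1) \<le> 1 / 2"
    using poly_reciprocal_approx[OF q half_gt_zero[OF zero_less_one]] by blast
  define e where "e = 1 - s * q"
  define g where "g = (\<lambda>n. \<Sum>k<n. e ^ k)"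
  define S where "S = (\<lambda>n. poly_op H (g n) T y)"
  have e_bound: "cmod (poly e z) \<le> 1 / 2" if "cmod z = 1" for z
    using s[of z] that by (simp add: e_def norm_minus_commute)
  have e_power: "cmod (poly (e ^ n) z) \<le> (1 / 2) ^ n" if "cmod z = 1" for z n
    using power_mono[OF e_bound[OF that], of n] by (simp add: norm_power)
  have g: "(1 - e) * g n = 1 - e ^ n" for n
    unfolding g_def by (rule one_diff_power_eq[symmetric])
  \<comment> \<open>Multiplying by \<open>1 - e\<close>, of modulus at least 1/2, telescopes the
    difference to \<open>e ^ n - e ^ m\<close>; the 4 is 2 for this division times 2 for the two
    terms.\<close>
  have g_diff: "cmod (poly (g m - g n) z) \<le> 4 * (1 / 2) ^ n" if "n \<le> m" "cmod z = 1" for m n z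
  proof -
    have "1 / 2 \<le> cmod (poly (1 - e) z)"
      using norm_triangle_ineq[of "poly (1 - e) z" "poly e z"] e_bound[OF that(2)] by simp
    then have "1 / 2 * cmod (poly (g m - g n) z) \<le> cmod (poly ((1 - e) * (g m - g n)) z)"
      unfolding poly_mult norm_mult by (rule mult_right_mono) simp
    also have "(1 - e) * (g m - g n) = e ^ n - e ^ m"
      by (simp add: right_diff_distrib g)
    also have "cmod (poly (e ^ n - e ^ m) z) \<le> (1 / 2) ^ n + (1 / 2) ^ m"
      unfolding poly_diff by (rule norm_triangle_le_diff) (intro add_mono e_power that)
    also have "\<dots> \<le> (1 / 2) ^ n + (1 / 2) ^ n"
      using that(1) by (intro add_mono power_decreasing) auto
    finally show ?thesis by simp
  qed
  have S_closed: "S n \<in> carrier H" for n using y by (simp add: S_def)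
  have S_diff: "hnorm H (S m \<ominus> S n) \<le> 4 * (1 / 2) ^ n * hnorm H y" if "n \<le> m" for m n
    unfolding S_def poly_op_diff[OF y, symmetric] by (intro von_neumann g_diff that y)
  have geom: "(\<lambda>n. (1 / 2 :: real) ^ n) \<longlonglongrightarrow> 0" by (intro LIMSEQ_realpow_zero) auto
  have "\<exists>N. \<forall>m\<ge>N. \<forall>n\<ge>N. hnorm H (S m \<ominus> S n) < \<epsilon>" if "\<epsilon> > 0" for \<epsilon>
  proof -
    \<comment> \<open>The constant 8 is twice 4: both \<open>S m\<close> and \<open>S n\<close> are
      compared with \<open>S N\<close>.\<close>
    have "(\<lambda>n. 8 * (1 / 2) ^ n * hnorm H y) \<longlonglongrightarrow> 8 * 0 * hnorm H y"
      by (intro tendsto_intros geom)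
    then have "\<forall>\<^sub>F n in sequentially. 8 * (1 / 2) ^ n * hnorm H y < \<epsilon>"
      using that by (intro order_tendstoD) auto
    then obtain N where N: "8 * (1 / 2) ^ N * hnorm H y < \<epsilon>" by (auto simp: eventually_sequentially)
    have "hnorm H (S m \<ominus> S n) < \<epsilon>" if "m \<ge> N" "n \<ge> N" for m n
      using hnorm_triangle_minus[of "S m" "S N" "S n"] S_closed S_diff[OF that(1)] S_diff[OF that(2)]
        hnorm_minus_commute[OF S_closed S_closed, of n N] N by simp
    then show ?thesis by blast
  qed
  then obtain z where z: "z \<in> carrier H" and lim: "(\<lambda>n. hnorm H (S n \<ominus> z)) \<longlonglongrightarrow> 0"
    using complete[of S] S_closed by blast
  define U where "U = poly_op H (1 - e) T"
  have U_closed: "U x \<in> carrier H" if "x \<in> carrier H" for x using that by (simp add: U_def)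
  \<comment> \<open>\<open>U (S n)\<close> differs from \<open>y\<close> by \<open>e ^ n\<close>
    applied to \<open>y\<close>, and \<open>U\<close> passes to the limit because
    \<open>1 - e\<close> is at most 2 on the circle.\<close>
  have bound: "hnorm H (y \<ominus> U z) \<le> (1 / 2) ^ n * hnorm H y + 2 * hnorm H (S n \<ominus> z)" for n
  proof -
    have "y \<ominus> U (S n) = poly_op H (e ^ n) T y"
    proof -
      have "1 - (1 - e) * g n = e ^ n" by (simp add: g)
      then have "poly_op H (e ^ n) T y = poly_op H (1 - (1 - e) * g n) T y" by simp
      also have "\<dots> = y \<ominus> U (S n)"
        using y by (simp only: poly_op_diff poly_op_one poly_op_mult U_def S_def)
      finally show ?thesis ..
    qed
    then have "hnorm H (y \<ominus> U (S n)) \<le> (1 / 2) ^ n * hnorm H y"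
      using y by (auto intro: von_neumann e_power)
    moreover have "hnorm H (U (S n) \<ominus> U z) \<le> 2 * hnorm H (S n \<ominus> z)"
    proof -
      have "cmod (poly (1 - e) w) \<le> 2" if "cmod w = 1" for w
        using norm_triangle_ineq4[of 1 "poly e w"] e_bound[OF that] by simp
      then show ?thesis unfolding U_def poly_op_diff_arg[OF S_closed z, symmetric]
        using S_closed z by (intro von_neumann) auto
    qed
    ultimately show ?thesis
      using hnorm_triangle_minus[OF y U_closed[OF S_closed] U_closed[OF z], of n] by linarith
  qed
  have "(\<lambda>n. (1 / 2) ^ n * hnorm H y + 2 * hnorm H (S n \<ominus> z)) \<longlonglongrightarrow> 0 * hnorm H y + 2 * 0"
    by (intro tendsto_intros geom lim)
  then have "hnorm H (y \<ominus> U z) \<le> 0 * hnorm H y + 2 * 0"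
    by (rule LIMSEQ_le_const) (use bound in auto)
  then have "hnorm H (y \<ominus> U z) = 0" using y U_closed[OF z] by (intro antisym hnorm_nonneg) auto
  then have "y = U z" using y U_closed[OF z] by (intro hnorm_minus_eq_zero)
  also have "\<dots> = poly_op H q T (poly_op H s T z)"
    using poly_op_mult[OF z, of q s] by (simp add: U_def e_def mult.commute)
  finally show ?thesis using that[of "poly_op H s T z"] z by simp
qed

text \<open>The case \<open>p = 1\<close> of \<open>von_neumann_rational\<close>, with
  \<open>M\<close> a bound of \<open>1 / |q|\<close> on the disc.\<close>

lemma poly_op_bounded_below:
  assumes q: "\<forall>z\<in>cball 0 1. poly q z \<noteq> 0"
  obtains K where "\<And>x. x \<in> carrier H \<Longrightarrow> hnorm H x \<le> K * hnorm H (poly_op H q T x)"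
proof -
  have "compact ((\<lambda>z. inverse (poly q z)) ` cball 0 1)"
    using q by (intro compact_continuous_image continuous_intros compact_cball) auto
  then obtain M where M: "\<And>z. z \<in> cball 0 1 \<Longrightarrow> cmod (inverse (poly q z)) \<le> M"
    using compact_imp_bounded bounded_iff by (metis imageI)
  have "0 \<le> M" using M[of 0] norm_ge_zero order_trans by (metis centre_in_cball zero_le_one)
  have "cmod (poly 1 z) \<le> M * cmod (poly q z)" if "z \<in> cball 0 1" for z
    using M[OF that] bspec[OF q that] by (simp add: norm_inverse inverse_eq_divide norm_divide divide_le_eq)
  from von_neumann_rational[OF q \<open>0 \<le> M\<close> this] show ?thesis
    using that[of M] by (simp add: that)
qed

lemma poly_op_inj:
  assumes q: "\<forall>z\<in>cball 0 1. poly q z \<noteq> 0"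
  shows "inj_on (poly_op H q T) (carrier H)"
proof (rule inj_onI)
  fix x y assume xy: "x \<in> carrier H" "y \<in> carrier H" "poly_op H q T x = poly_op H q T y"
  obtain K where K: "\<And>x. x \<in> carrier H \<Longrightarrow> hnorm H x \<le> K * hnorm H (poly_op H q T x)"
    using poly_op_bounded_below[OF q] by blast
  have "hnorm H (x \<ominus> y) \<le> K * hnorm H (poly_op H q T y \<ominus> poly_op H q T y)"
    using K[of "x \<ominus> y"] xy by (simp add: poly_op_diff_arg)
  also have "poly_op H q T y \<ominus> poly_op H q T y = \<zero>"
    using xy by (simp add: M.minus_eq M.r_neg)
  finally have "hnorm H (x \<ominus> y) = 0" using xy by (intro antisym hnorm_nonneg) auto
  then show "x = y" using xy by (intro hnorm_minus_eq_zero)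
qed

lemma invertible_poly_op:
  assumes q: "\<forall>z\<in>cball 0 1. poly q z \<noteq> 0"
  shows "invertible_operator H (poly_op H q T)"
proof -
  let ?Q = "poly_op H q T"
  define S where "S = inv_into (carrier H) ?Q"
  have surj: "y \<in> ?Q ` carrier H" if "y \<in> carrier H" for y
    using poly_op_surj[OF q that] by (metis imageI)
  have S_closed: "S y \<in> carrier H" and QS: "?Q (S y) = y" if "y \<in> carrier H" for y
    unfolding S_def using surj[OF that] by (auto intro: inv_into_into f_inv_into_f)
  have SQ: "S (?Q x) = x" if "x \<in> carrier H" for x
    unfolding S_def by (rule inv_into_f_f[OF poly_op_inj[OF q] that])
  have S_add: "S (x \<oplus> y) = S x \<oplus> S y" if "x \<in> carrier H" "y \<in> carrier H" for x y
    using SQ[of "S x \<oplus> S y"] that by (simp add: poly_op_add_arg S_closed QS)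
  have S_scale: "S (c \<odot> x) = c \<odot> S x" if "x \<in> carrier H" for c x
    using SQ[of "c \<odot> S x"] that by (simp add: poly_op_scale_arg S_closed QS)
  obtain K where "\<And>x. x \<in> carrier H \<Longrightarrow> hnorm H x \<le> K * hnorm H (?Q x)"
    using poly_op_bounded_below[OF q] by blast
  then have "\<forall>y\<in>carrier H. hnorm H (S y) \<le> K * hnorm H y"
    using S_closed QS by metis
  then have "bounded_operator H S"
    unfolding bounded_operator_def using S_closed S_add S_scale by blast
  then show ?thesis
    unfolding invertible_operator_def using bounded_poly_op SQ QS by blast
qed

lemma spectrum_subset: "spectrum H T \<subseteq> cball 0 1"
proof
  fix z assume z: "z \<in> spectrum H T"
  show "z \<in> cball 0 1"
  proof (rule ccontr)
    assume "z \<notin> cball 0 1"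
    then have "\<forall>w\<in>cball 0 1. poly [:- z, 1:] w \<noteq> 0" by (auto simp: add_eq_0_iff)
    then have "invertible_operator H (poly_op H [:- z, 1:] T)" by (rule invertible_poly_op)
    moreover have "poly_op H [:- z, 1:] T x = T x \<ominus> z \<odot> x" if "x \<in> carrier H" for x
      using that by (simp add: poly_op_pCons T_scale minus_scale scale_scale[symmetric] M.a_comm)
    \<comment> \<open>Invertibility looks only at values on the carrier, so the two operators may be
      exchanged.\<close>
    ultimately have "invertible_operator H (\<lambda>x. T x \<ominus> z \<odot> x)"
      by (simp add: invertible_operator_def bounded_operator_def Pi_def cong: conj_cong)
    then show False using z by (simp add: spectrum_def)
  qed
qed

text \<open>If \<open>x\<close> is the image of \<open>y\<close> under the inverse of
  \<open>q(T)\<close>, the rational function sends \<open>y\<close> to \<open>p(T) x\<close> while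
  \<open>y = q(T) x\<close>, so \<open>von_neumann_rational\<close> applies with \<open>M\<close>
  the supremum norm.\<close>

lemma spectral_set_disc: "spectral_set (cball 0 1) H T"
proof -
  have "op_norm H (rat_op H f T) \<le> sup_norm (cball 0 1) (rat_eval f)" if "f \<in> Rat (cball 0 1)" for f
  proof -
    obtain p q where f: "f = (p, q)" and q: "\<forall>z\<in>cball 0 1. poly q z \<noteq> 0"
      using \<open>f \<in> Rat _\<close> by (auto simp: Rat_def)
    define M where "M = sup_norm (cball 0 1) (rat_eval f)"
    have "compact ((\<lambda>z. cmod (rat_eval f z)) ` cball 0 1)"
      unfolding f rat_eval_def using q by (intro compact_continuous_image continuous_intros compact_cball) auto
    then have "bdd_above ((\<lambda>z. cmod (rat_eval f z)) ` cball 0 1)"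
      by (intro bounded_imp_bdd_above compact_imp_bounded)
    then have M: "cmod (rat_eval f z) \<le> M" if "z \<in> cball 0 1" for z
      using that unfolding M_def sup_norm_def by (auto intro: cSUP_upper)
    have M0: "0 \<le> M" using M[of 0] norm_ge_zero order_trans by (metis centre_in_cball zero_le_one)
    have pq: "cmod (poly p z) \<le> M * cmod (poly q z)" if "z \<in> cball 0 1" for z
      using M[OF that] q that by (simp add: f rat_eval_def norm_divide divide_le_eq)
    have "hnorm H (rat_op H f T y) \<le> M" if y: "y \<in> carrier H" "hnorm H y \<le> 1" for y
    proof -
      define x where "x = op_inverse H (poly_op H q T) y"
      obtain x' where x': "x' \<in> carrier H" "poly_op H q T x' = y" using poly_op_surj[OF q y(1)] .
      then have x: "x \<in> carrier H" "poly_op H q T x = y"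
        unfolding x_def op_inverse_def using inv_into_f_f[OF poly_op_inj[OF q]] by auto
      have "hnorm H (rat_op H f T y) = hnorm H (poly_op H p T x)" by (simp add: rat_op_def f x_def)
      also have "\<dots> \<le> M * hnorm H y" using von_neumann_rational[OF q M0 pq x(1)] x(2) by simp
      also have "\<dots> \<le> M" using y(2) M0 mult_left_le by blast
      finally show ?thesis .
    qed
    then show ?thesis
      unfolding op_norm_def M_def[symmetric] by (intro cSUP_least) (auto intro!: exI[of _ \<zero>])
  qed
  then show ?thesis using spectrum_subset by (simp add: spectral_set_def)
qed

end

section \<open>Members of \<open>C1\<close> are contractions\<close>

text \<open>The real supremum in \<open>op_norm\<close> is known to dominate its members only once
  the set is bounded above.\<close>

lemma (in complex_hilbert_space) bdd_above_unit_ball_image: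
  assumes "bounded_operator H T"
  shows "bdd_above ((\<lambda>x. hnorm H (T x)) ` {x \<in> carrier H. hnorm H x \<le> 1})"
proof -
  obtain K where K: "\<forall>x\<in>carrier H. hnorm H (T x) \<le> K * hnorm H x"
    using assms by (auto simp: bounded_operator_def)
  \<comment> \<open>On the zero space \<open>K\<close> may be negative, hence the absolute
    value.\<close>
  have "hnorm H (T x) \<le> \<bar>K\<bar>" if "x \<in> carrier H" "hnorm H x \<le> 1" for x
  proof -
    have "hnorm H (T x) \<le> \<bar>K\<bar> * hnorm H x"
      using K that(1) by (meson abs_ge_self hnorm_nonneg mult_right_mono order_trans)
    also have "\<dots> \<le> \<bar>K\<bar>" using that(2) mult_left_le[of "hnorm H x" "\<bar>K\<bar>"] by simp
    finally show ?thesis .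
  qed
  then show ?thesis by (intro bdd_aboveI2) auto
qed

lemma (in complex_hilbert_space) hnorm_le_op_norm:
  assumes "bounded_operator H T" "x \<in> carrier H" "hnorm H x \<le> 1"
  shows "hnorm H (T x) \<le> op_norm H T"
  unfolding op_norm_def using assms by (intro cSUP_upper bdd_above_unit_ball_image) auto

lemma (in complex_hilbert_space) op_norm_le_one_imp_contraction:
  assumes T: "bounded_operator H T" "op_norm H T \<le> 1" and x: "x \<in> carrier H"
  shows "hnorm H (T x) \<le> hnorm H x"
proof -
  interpret hilbert_operator H T by standard (rule T(1))
  show ?thesis
  proof (cases "x = \<zero>")
    case False
    then have pos: "hnorm H x > 0" using x hnorm_eq_zero hnorm_nonneg[OF x] by (simp add: less_le)
    let ?u = "of_real (1 / hnorm H x) \<odot> x"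
    have "hnorm H (T ?u) \<le> 1"
      using hnorm_le_op_norm[OF T(1), of ?u] T(2) x pos by (simp add: hnorm_scale norm_divide)
    then show ?thesis using x pos by (simp add: T_scale hnorm_scale norm_divide divide_le_eq)
  qed simp
qed

lemma C1_spectral_set_disc:
  assumes "(H, T) \<in> C1 r"
  shows "spectral_set (cball 0 1) H T"
proof -
  interpret complex_hilbert_space H using assms by (simp add: C1_def)
  have "bounded_operator H T" "op_norm H T \<le> 1"
    using assms by (auto simp: C1_def invertible_operator_def)
  then interpret hilbert_contraction H T
    by unfold_locales (auto intro: op_norm_le_one_imp_contraction)
  show ?thesis by (rule spectral_set_disc)
qed

section \<open>Jordan blocks on two-dimensional spaces\<close>

lemma cring_complex_ring: "cring complex_ring"
proof (rule cringI)
  show "abelian_group complex_ring"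
  proof (rule abelian_groupI)
    show "\<exists>y\<in>carrier complex_ring. y \<oplus>\<^bsub>complex_ring\<^esub> x = \<zero>\<^bsub>complex_ring\<^esub>" for x
      by (auto intro: exI[of _ "- x"])
  qed (auto simp: algebra_simps)
  show "Group.comm_monoid complex_ring"
    by (rule comm_monoidI) (auto simp: algebra_simps)
qed (auto simp: algebra_simps)

text \<open>The space \<open>C^2\<close>, transported along \<phi> into the universe
  \<open>'a\<close> from which carriers are drawn.\<close>

definition plane :: "(complex \<times> complex \<Rightarrow> 'a) \<Rightarrow> 'a inner_space" where
  "plane \<phi> = \<lparr>carrier = range \<phi>, mult = (\<lambda>_ _. \<phi> 0), one = \<phi> 0, zero = \<phi> 0,
     add = (\<lambda>x y. \<phi> (inv_into UNIV \<phi> x + inv_into UNIV \<phi> y)),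
     smult = (\<lambda>c x. \<phi> (c * fst (inv_into UNIV \<phi> x), c * snd (inv_into UNIV \<phi> x))),
     cinner = (\<lambda>x y. fst (inv_into UNIV \<phi> x) * cnj (fst (inv_into UNIV \<phi> y)) + snd (inv_into UNIV \<phi> x) * cnj (snd (inv_into UNIV \<phi> y)))\<rparr>"

text \<open>The matrix \<open>[[a, s], [0, a]]\<close>. Such matrices multiply like dual numbers, so
  functions act on them through value and first derivative.\<close>

definition jordan :: "(complex \<times> complex \<Rightarrow> 'a) \<Rightarrow> complex \<Rightarrow> complex \<Rightarrow> 'a \<Rightarrow> 'a" where
  "jordan \<phi> a s x = \<phi> (a * fst (inv_into UNIV \<phi> x) + s * snd (inv_into UNIV \<phi> x), a * snd (inv_into UNIV \<phi> x))"

context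
  fixes \<phi> :: "complex \<times> complex \<Rightarrow> 'a"
  assumes inj: "inj \<phi>"
begin

lemma inv_phi [simp]: "inv_into UNIV \<phi> (\<phi> p) = p"
  using inj by simp

lemma plane_simps [simp]:
  "carrier (plane \<phi>) = range \<phi>"
  "\<zero>\<^bsub>plane \<phi>\<^esub> = \<phi> 0"
  "\<phi> p \<oplus>\<^bsub>plane \<phi>\<^esub> \<phi> q = \<phi> (p + q)"
  "c \<odot>\<^bsub>plane \<phi>\<^esub> \<phi> p = \<phi> (c * fst p, c * snd p)"
  "cinner (plane \<phi>) (\<phi> p) (\<phi> q) = fst p * cnj (fst q) + snd p * cnj (snd q)"
  by (simp_all add: plane_def)

text \<open>The norm of the product type is Euclidean too, so completeness of the plane is inherited
  from it.\<close>

lemma hnorm_plane [simp]: "hnorm (plane \<phi>) (\<phi> p) = norm p"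
  by (simp add: hnorm_def norm_prod_def complex_mult_cnj cmod_power2)

lemma jordan_phi [simp]: "jordan \<phi> a s (\<phi> p) = \<phi> (a * fst p + s * snd p, a * snd p)"
  by (simp add: jordan_def)

lemma module_plane: "Module.module complex_ring (plane \<phi>)"
proof (rule moduleI)
  show "abelian_group (plane \<phi>)"
  proof (rule abelian_groupI)
    fix x assume "x \<in> carrier (plane \<phi>)"
    then obtain p where p: "x = \<phi> p" by auto
    show "\<exists>y\<in>carrier (plane \<phi>). y \<oplus>\<^bsub>plane \<phi>\<^esub> x = \<zero>\<^bsub>plane \<phi>\<^esub>"
      by (rule bexI[of _ "\<phi> (- p)"]) (auto simp: p)
  qed (auto simp: algebra_simps)
qed (auto simp: cring_complex_ring algebra_simps)

lemma a_minus_plane: "\<phi> p \<ominus>\<^bsub>plane \<phi>\<^esub> \<phi> q = \<phi> (p - q)"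
proof -
  interpret Module.module complex_ring "plane \<phi>" by (rule module_plane)
  have "\<ominus>\<^bsub>plane \<phi>\<^esub> \<phi> q = \<phi> (- q)" by (rule M.minus_equality) auto
  then show ?thesis by (simp add: M.minus_eq)
qed

lemma hilbert_plane: "complex_hilbert_space (plane \<phi>)"
proof (intro complex_hilbert_space.intro complex_hilbert_space_axioms.intro)
  show "Module.module complex_ring (plane \<phi>)" by (rule module_plane)
next
  fix x assume x: "x \<in> carrier (plane \<phi>)"
  then show "0 \<le> Re (cinner (plane \<phi>) x x)" by auto
  assume "cinner (plane \<phi>) x x = 0"
  then have "hnorm (plane \<phi>) x = 0" by (simp only: hnorm_def) simp
  moreover from x obtain p where "x = \<phi> p" by auto
  ultimately show "x = \<zero>\<^bsub>plane \<phi>\<^esub>" by simp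
next
  fix s :: "nat \<Rightarrow> 'a"
  assume "range s \<subseteq> carrier (plane \<phi>)"
  then have "s n \<in> range \<phi>" for n by auto
  then have "\<forall>n. \<exists>p. s n = \<phi> p" by blast
  then obtain t where t: "s n = \<phi> (t n)" for n by metis
  assume "\<forall>\<epsilon>>0. \<exists>N. \<forall>m\<ge>N. \<forall>n\<ge>N. hnorm (plane \<phi>) (s m \<ominus>\<^bsub>plane \<phi>\<^esub> s n) < \<epsilon>"
  then have "Cauchy t" by (simp add: Cauchy_def t a_minus_plane dist_norm)
  then obtain l where "t \<longlonglongrightarrow> l" using Cauchy_convergent convergent_def by blast
  then have "(\<lambda>n. hnorm (plane \<phi>) (s n \<ominus>\<^bsub>plane \<phi>\<^esub> \<phi> l)) \<longlonglongrightarrow> 0"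
    by (simp add: t a_minus_plane LIM_zero_iff tendsto_norm_zero_iff)
  then show "\<exists>x\<in>carrier (plane \<phi>). (\<lambda>n. hnorm (plane \<phi>) (s n \<ominus>\<^bsub>plane \<phi>\<^esub> x)) \<longlonglongrightarrow> 0"
    by (rule bexI) simp
qed (auto simp: algebra_simps)

lemma jordan_bounded: "bounded_operator (plane \<phi>) (jordan \<phi> a s)"
proof -
  have "norm (a * fst p + s * snd p, a * snd p) \<le> (cmod a + cmod s + cmod a) * norm p" for p
  proof -
    have "norm (a * fst p + s * snd p, a * snd p) \<le> cmod (a * fst p + s * snd p) + cmod (a * snd p)"
      by (rule norm_Pair_le)
    also have "\<dots> \<le> cmod a * cmod (fst p) + cmod s * cmod (snd p) + cmod a * cmod (snd p)"
      using norm_triangle_ineq[of "a * fst p" "s * snd p"] by (simp add: norm_mult)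
    also have "\<dots> \<le> cmod a * norm p + cmod s * norm p + cmod a * norm p"
      by (intro add_mono mult_left_mono norm_fst_le[of "fst p" "snd p", simplified]
          norm_snd_le[of "snd p" "fst p", simplified]) auto
    finally show ?thesis by (simp add: algebra_simps)
  qed
  then have "\<forall>x\<in>carrier (plane \<phi>). hnorm (plane \<phi>) (jordan \<phi> a s x)
      \<le> (cmod a + cmod s + cmod a) * hnorm (plane \<phi>) x"
    by (simp del: fst_conv snd_conv split_paired_All)
  then have "\<exists>K. \<forall>x\<in>carrier (plane \<phi>). hnorm (plane \<phi>) (jordan \<phi> a s x) \<le> K * hnorm (plane \<phi>) x"
    by (rule exI)
  then show ?thesis
    unfolding bounded_operator_def by (intro conjI) (auto simp: algebra_simps)
qed

text \<open>The off-diagonal entry of the inverse is \<open>s\<close> times the derivative of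
  \<open>1 / z\<close> at \<open>a\<close>.\<close>

lemma jordan_inverse:
  assumes "a \<noteq> 0" "x \<in> carrier (plane \<phi>)"
  shows "jordan \<phi> (1 / a) (- s / a\<^sup>2) (jordan \<phi> a s x) = x"
    and "jordan \<phi> a s (jordan \<phi> (1 / a) (- s / a\<^sup>2) x) = x"
  using assms by (auto simp: field_simps power2_eq_square)

lemma jordan_invertible: "a \<noteq> 0 \<Longrightarrow> invertible_operator (plane \<phi>) (jordan \<phi> a s)"
  unfolding invertible_operator_def using jordan_bounded jordan_inverse by blast

lemma op_inverse_jordan:
  assumes a: "a \<noteq> 0" and x: "x \<in> carrier (plane \<phi>)"
  shows "op_inverse (plane \<phi>) (jordan \<phi> a s) x = jordan \<phi> (1 / a) (- s / a\<^sup>2) x"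
proof -
  have "inj_on (jordan \<phi> a s) (carrier (plane \<phi>))"
    using jordan_inverse(1)[OF a] by (rule inj_on_inverseI)
  moreover have "jordan \<phi> (1 / a) (- s / a\<^sup>2) x \<in> carrier (plane \<phi>)" using x by auto
  ultimately show ?thesis
    unfolding op_inverse_def using jordan_inverse(2)[OF a x] by (metis inv_into_f_f)
qed

text \<open>After the triangle inequality, the bound on \<open>s\<close> lets the squared norm drop
  by at least \<open>S * (X - A * Y)^2\<close> with \<open>S = 1 - A^2\<close>.\<close>

lemma jordan_op_norm_le:
  assumes s: "cmod s \<le> 1 - (cmod a)\<^sup>2"
  shows "op_norm (plane \<phi>) (jordan \<phi> a s) \<le> 1"
proof -
  have "norm (a * x + s * y, a * y) \<le> norm (x, y)" for x y
  proof -
    define A S X Y where "A = cmod a" and "S = 1 - A\<^sup>2" and "X = cmod x" and "Y = cmod y"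
    have S: "0 \<le> S" using s norm_ge_zero[of s] by (simp add: S_def A_def del: norm_ge_zero)
    have "cmod (a * x + s * y) \<le> A * X + S * Y"
      using norm_triangle_ineq[of "a * x" "s * y"] mult_right_mono[OF s, of Y]
      by (simp add: A_def S_def X_def Y_def norm_mult)
    then have "(cmod (a * x + s * y))\<^sup>2 \<le> (A * X + S * Y)\<^sup>2" by (intro power_mono) auto
    moreover have "X\<^sup>2 + Y\<^sup>2 - ((A * X + S * Y)\<^sup>2 + (A * Y)\<^sup>2) = S * (X - A * Y)\<^sup>2"
      unfolding S_def by (simp add: power2_eq_square algebra_simps)
    moreover have "0 \<le> S * (X - A * Y)\<^sup>2" using S by simp
    ultimately have "(cmod (a * x + s * y))\<^sup>2 + (A * Y)\<^sup>2 \<le> X\<^sup>2 + Y\<^sup>2" by linarith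
    then show ?thesis by (simp add: norm_prod_def norm_mult A_def X_def Y_def)
  qed
  then have "norm (a * fst p + s * snd p, a * snd p) \<le> 1" if "norm p \<le> 1" for p
    using that by (metis order_trans prod.collapse)
  moreover have "\<phi> 0 \<in> {x \<in> carrier (plane \<phi>). hnorm (plane \<phi>) x \<le> 1}" by simp
  moreover have "hnorm (plane \<phi>) (jordan \<phi> a s x) \<le> 1"
    if "x \<in> {x \<in> carrier (plane \<phi>). hnorm (plane \<phi>) x \<le> 1}" for x
    using that calculation(1) by auto
  ultimately show ?thesis unfolding op_norm_def
    by (intro cSUP_least) blast+
qed

text \<open>The last hypothesis is the contraction criterion for \<open>r\<close> times the inverse,
  which is again a Jordan block, with entries \<open>r / a\<close> and
  \<open>- r * s / a^2\<close>.\<close>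

lemma jordan_in_C1:
  assumes r: "0 \<le> r" and a: "a \<noteq> 0" and s: "cmod s \<le> 1 - (cmod a)\<^sup>2"
    and rs: "r * cmod s / (cmod a)\<^sup>2 \<le> 1 - (r / cmod a)\<^sup>2"
  shows "(plane \<phi>, jordan \<phi> a s) \<in> C1 r"
proof -
  have "op_norm (plane \<phi>) (\<lambda>x. of_real r \<odot>\<^bsub>plane \<phi>\<^esub> op_inverse (plane \<phi>) (jordan \<phi> a s) x)
    = op_norm (plane \<phi>) (jordan \<phi> (of_real r / a) (- of_real r * s / a\<^sup>2))"
    unfolding op_norm_def
    by (intro arg_cong[where f = Sup] image_cong refl)
      (auto simp: op_inverse_jordan[OF a] field_simps)
  also have "\<dots> \<le> 1"
    using rs r by (intro jordan_op_norm_le) (simp add: norm_divide norm_mult norm_power)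
  finally show ?thesis
    using a s by (simp add: C1_def hilbert_plane jordan_invertible jordan_op_norm_le)
qed

text \<open>A left inverse would have to separate the eigenvector \<open>\<phi> (1, 0)\<close> from
  \<open>\<phi> 0\<close>, which have the same image.\<close>

lemma eigenvalue_in_spectrum: "a \<in> spectrum (plane \<phi>) (jordan \<phi> a s)"
proof -
  have "jordan \<phi> a s (\<phi> (1, 0)) \<ominus>\<^bsub>plane \<phi>\<^esub> a \<odot>\<^bsub>plane \<phi>\<^esub> \<phi> (1, 0)
    = jordan \<phi> a s (\<phi> 0) \<ominus>\<^bsub>plane \<phi>\<^esub> a \<odot>\<^bsub>plane \<phi>\<^esub> \<phi> 0"
    by (simp add: a_minus_plane)
  then have "\<phi> (1, 0) = \<phi> 0"
    if "\<forall>x\<in>carrier (plane \<phi>). S (jordan \<phi> a s x \<ominus>\<^bsub>plane \<phi>\<^esub> a \<odot>\<^bsub>plane \<phi>\<^esub> x) = x" for S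
    using bspec[OF that, of "\<phi> (1, 0)"] bspec[OF that, of "\<phi> 0"] by simp
  moreover have "\<phi> (1, 0) \<noteq> \<phi> 0" using inj by (auto dest: injD simp: zero_prod_def)
  ultimately show ?thesis unfolding spectrum_def invertible_operator_def by blast
qed

text \<open>Each Horner step is the product rule for the derivative of \<open>X p\<close>.\<close>

lemma poly_op_jordan:
  assumes x: "x \<in> carrier (plane \<phi>)"
  shows "poly_op (plane \<phi>) p (jordan \<phi> a s) x = jordan \<phi> (poly p a) (s * poly (pderiv p) a) x"
proof -
  interpret hilbert_operator "plane \<phi>" "jordan \<phi> a s"
    by (intro hilbert_operator.intro hilbert_operator_axioms.intro hilbert_plane jordan_bounded)
  show ?thesis
  proof (induction p)
    case 0
    from x show ?case by (auto simp: zero_prod_def)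
  next
    case (pCons c p)
    from x pCons.IH show ?case by (auto simp: poly_op_pCons pderiv_pCons algebra_simps)
  qed
qed

text \<open>Where \<open>p\<close> vanishes, the derivative of \<open>p / q\<close> is
  \<open>p' / q\<close> and only the off-diagonal entry remains; the second basis vector picks it
  out.\<close>

lemma op_norm_rat_op_jordan_ge:
  assumes p: "poly p a = 0" and q: "poly q a \<noteq> 0"
  shows "cmod (s * poly (pderiv p) a / poly q a) \<le> op_norm (plane \<phi>) (rat_op (plane \<phi>) (p, q) (jordan \<phi> a s))"
proof -
  interpret complex_hilbert_space "plane \<phi>" by (rule hilbert_plane)
  let ?J = "jordan \<phi> 0 (s * poly (pderiv p) a / poly q a)"
  \<comment> \<open>\<open>inv_into\<close> looks only at values on the carrier, where
    \<open>poly_op_jordan\<close> applies.\<close>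
  have Q: "op_inverse (plane \<phi>) (poly_op (plane \<phi>) q (jordan \<phi> a s)) x
    = op_inverse (plane \<phi>) (jordan \<phi> (poly q a) (s * poly (pderiv q) a)) x" for x
    unfolding op_inverse_def inv_into_def by (metis (no_types, lifting) poly_op_jordan)
  have "rat_op (plane \<phi>) (p, q) (jordan \<phi> a s) x = ?J x" if "x \<in> carrier (plane \<phi>)" for x
    using that q by (auto simp: rat_op_def Q op_inverse_jordan poly_op_jordan p field_simps)
  then have "op_norm (plane \<phi>) (rat_op (plane \<phi>) (p, q) (jordan \<phi> a s)) = op_norm (plane \<phi>) ?J"
    unfolding op_norm_def by (intro arg_cong[where f = Sup] image_cong refl) auto
  moreover have "hnorm (plane \<phi>) (?J (\<phi> (0, 1))) \<le> op_norm (plane \<phi>) ?J"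
    by (intro hnorm_le_op_norm jordan_bounded) (auto simp: norm_prod_def)
  ultimately show ?thesis by (simp add: norm_prod_def)
qed

end

section \<open>A rational function with a large derivative\<close>

lemma blaschke_identity:
  "(cmod (1 - cnj \<alpha> * z))\<^sup>2 - (cmod (z - \<alpha>))\<^sup>2 = (1 - (cmod \<alpha>)\<^sup>2) * (1 - (cmod z)\<^sup>2)"
  unfolding cmod_power2 by (simp add: power2_eq_square algebra_simps)

lemma blaschke_denominator_bounds:
  assumes "cmod z \<le> 1"
  shows "1 - cmod \<alpha> \<le> cmod (1 - cnj \<alpha> * z)" and "cmod (1 - cnj \<alpha> * z) \<le> 1 + cmod \<alpha>"
proof -
  have "cmod (cnj \<alpha> * z) \<le> cmod \<alpha>" using assms by (simp add: norm_mult mult_left_le)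
  then show "1 - cmod \<alpha> \<le> cmod (1 - cnj \<alpha> * z)" "cmod (1 - cnj \<alpha> * z) \<le> 1 + cmod \<alpha>"
    using norm_triangle_ineq2[of 1 "cnj \<alpha> * z"] norm_triangle_ineq4[of 1 "cnj \<alpha> * z"] by simp_all
qed

text \<open>By \<open>blaschke_identity\<close> the quantity is
  \<open>(1 - |\<alpha>|^2) (1 - |z|^2) / |1 - cnj \<alpha> z|^2\<close>, with denominator between
  \<open>(1 - |\<alpha>|)^2\<close> and 4. Both bounds together make different Blaschke factors
  comparable.\<close>

lemma one_minus_blaschke_square_bounds:
  assumes \<alpha>: "cmod \<alpha> < 1" and z: "cmod z \<le> 1"
  defines "b \<equiv> (z - \<alpha>) / (1 - cnj \<alpha> * z)"
  shows "(1 - (cmod \<alpha>)\<^sup>2) / 4 * (1 - (cmod z)\<^sup>2) \<le> 1 - (cmod b)\<^sup>2"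
    and "1 - (cmod b)\<^sup>2 \<le> (1 - (cmod z)\<^sup>2) / (1 - cmod \<alpha>)\<^sup>2"
proof -
  define d where "d = cmod (1 - cnj \<alpha> * z)"
  have d: "1 - cmod \<alpha> \<le> d" "d \<le> 2" "d > 0"
    using blaschke_denominator_bounds[OF z, of \<alpha>] \<alpha> by (auto simp: d_def simp del: zero_less_norm_iff)
  have E: "0 \<le> 1 - (cmod z)\<^sup>2" using z by (simp add: power_le_one)
  have A: "0 \<le> 1 - (cmod \<alpha>)\<^sup>2" using \<alpha> by (simp add: power_le_one)
  have b: "1 - (cmod b)\<^sup>2 = (1 - (cmod \<alpha>)\<^sup>2) * (1 - (cmod z)\<^sup>2) / d\<^sup>2"
  proof -
    have "(cmod b)\<^sup>2 = (cmod (z - \<alpha>))\<^sup>2 / d\<^sup>2" by (simp only: b_def norm_divide power_divide d_def)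
    then show ?thesis
      unfolding blaschke_identity[symmetric] d_def[symmetric] using d(3) by (simp add: diff_divide_distrib)
  qed
  have "d\<^sup>2 \<le> 2\<^sup>2" using d by (intro power_mono) auto
  then have "(1 - (cmod \<alpha>)\<^sup>2) * (1 - (cmod z)\<^sup>2) / 4 \<le> (1 - (cmod \<alpha>)\<^sup>2) * (1 - (cmod z)\<^sup>2) / d\<^sup>2"
    using d A E by (intro divide_left_mono mult_nonneg_nonneg mult_pos_pos) auto
  then show "(1 - (cmod \<alpha>)\<^sup>2) / 4 * (1 - (cmod z)\<^sup>2) \<le> 1 - (cmod b)\<^sup>2" by (simp add: b)
  have "(1 - cmod \<alpha>)\<^sup>2 \<le> d\<^sup>2" using d \<alpha> by (intro power_mono) auto
  moreover have "(1 - (cmod \<alpha>)\<^sup>2) * (1 - (cmod z)\<^sup>2) \<le> 1 * (1 - (cmod z)\<^sup>2)"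
    using E by (intro mult_right_mono) auto
  ultimately show "1 - (cmod b)\<^sup>2 \<le> (1 - (cmod z)\<^sup>2) / (1 - cmod \<alpha>)\<^sup>2"
    unfolding b using \<alpha> E by (intro frac_le) auto
qed

text \<open>On the unit circle \<open>cnj c / w\<close> is the conjugate of \<open>c * w\<close>, so
  the difference is purely imaginary; inside, its real part is \<open>- Re (c * w)\<close> times
  \<open>(1 - |w|^2) / |w|^2\<close>.\<close>

lemma Re_diff_reflection_le:
  assumes "w \<noteq> 0" "cmod w \<le> 1" "cmod c \<le> 1"
  shows "Re (c * w - cnj c / w) \<le> (1 - (cmod w)\<^sup>2) / cmod w"
proof -
  have "cnj c / w = cnj (c * w) / of_real ((cmod w)\<^sup>2)"
    unfolding complex_norm_square using assms(1) by simp
  then have "Re (cnj c / w) = Re (c * w) / (cmod w)\<^sup>2"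
    by (simp only: Re_divide_of_real) simp
  then have "Re (c * w - cnj c / w) = - Re (c * w) * ((1 - (cmod w)\<^sup>2) / (cmod w)\<^sup>2)"
    using assms(1) by (simp only: minus_complex.sel) (simp add: diff_divide_distrib right_diff_distrib del: times_complex.sel)
  also have "\<dots> \<le> cmod w * ((1 - (cmod w)\<^sup>2) / (cmod w)\<^sup>2)"
  proof (rule mult_right_mono)
    have "- Re (c * w) \<le> cmod c * cmod w"
      using abs_Re_le_cmod[of "c * w"] by (simp add: norm_mult)
    also have "\<dots> \<le> cmod w" using assms(3) mult_right_mono[of "cmod c" 1 "cmod w"] by simp
    finally show "- Re (c * w) \<le> cmod w" .
  qed (use assms(2) in \<open>simp add: power_le_one\<close>)
  also have "\<dots> = (1 - (cmod w)\<^sup>2) / cmod w" using assms(1) by (simp add: power2_eq_square)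
  finally show ?thesis .
qed

lemma cmod_one_plus_square:
  "(cmod (1 + of_real t * h))\<^sup>2 = 1 + 2 * t * Re h + t\<^sup>2 * (cmod h)\<^sup>2"
  unfolding cmod_power2 by (simp add: power2_eq_square algebra_simps)

lemma small_parameter:
  fixes C K k \<eta> :: real
  assumes "0 \<le> C" "0 < K" "0 < k" "0 < \<eta>"
  obtains t where "0 < t" "2 * t * C \<le> k" "t * K \<le> \<eta>"
proof
  let ?t = "min (k / (2 * (C + 1))) (\<eta> / K)"
  show "0 < ?t" using assms by simp
  have "2 * ?t * C \<le> 2 * (k / (2 * (C + 1))) * C" using assms by (intro mult_mono) auto
  also have "\<dots> \<le> k" using assms by (simp add: field_simps)
  finally show "2 * ?t * C \<le> k" .
  have "?t * K \<le> \<eta> / K * K" using assms by (intro mult_right_mono) auto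
  then show "?t * K \<le> \<eta>" using assms by simp
qed

lemma compact_continuous_bounded:
  fixes f :: "complex \<Rightarrow> complex"
  assumes "compact X" "continuous_on X f"
  obtains M where "0 < M" "\<And>z. z \<in> X \<Longrightarrow> cmod (f z) \<le> M"
proof -
  have "bounded (f ` X)" using assms by (intro compact_imp_bounded compact_continuous_image)
  then show ?thesis using that by (auto simp: bounded_pos)
qed

text \<open>A holomorphic function bounded by 1 on the disc and zero at \<alpha> has
  \<open>(1 - |\<alpha>|^2) |f'(\<alpha>)| <= 1\<close> by Schwarz-Pick; a pole at
  \<open>z0\<close>, available since \<open>z0\<close> is off \<open>X\<close>, lets the quotient
  beat this.\<close>

lemma rational_peak:
  assumes X: "compact X" "X \<subseteq> cball 0 1" and z0: "z0 \<notin> X" "cmod z0 < 1"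
    and \<alpha>: "cmod \<alpha> < 1" "\<alpha> \<noteq> z0"
  obtains p q where "(p, q) \<in> Rat X" "poly p \<alpha> = 0" "poly q \<alpha> \<noteq> 0"
    "sup_norm X (rat_eval (p, q)) < cmod (of_real (1 - (cmod \<alpha>)\<^sup>2) * poly (pderiv p) \<alpha> / poly q \<alpha>)"
proof -
  define w where "w = (\<lambda>z. (z - z0) / (1 - cnj z0 * z))"
  define b where "b = (\<lambda>z. (z - \<alpha>) / (1 - cnj \<alpha> * z))"
  \<comment> \<open>This choice makes \<open>h \<alpha>\<close> the positive number
    \<open>1 - |w \<alpha>|^2\<close>.\<close>
  define c where "c = - cnj (w \<alpha>)"
  define h where "h = (\<lambda>z. c * w z - cnj c / w z)"
  have denom: "1 - cnj \<beta> * z \<noteq> 0" if "cmod \<beta> < 1" "cmod z \<le> 1" for \<beta> z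
    using blaschke_denominator_bounds(1)[OF that(2), of \<beta>] that(1) by auto
  have X1: "cmod z \<le> 1" if "z \<in> X" for z using X that by auto
  have w0: "w z \<noteq> 0" if "cmod z \<le> 1" "z \<noteq> z0" for z
    using denom[OF z0(2) that(1)] that(2) by (simp add: w_def)
  have wX: "w z \<noteq> 0" if "z \<in> X" for z using w0[OF X1[OF that]] that z0 by auto
  define \<eta> where "\<eta> = 1 - (cmod (w \<alpha>))\<^sup>2"
  have \<alpha>2: "(cmod \<alpha>)\<^sup>2 < 1" using \<alpha> by (simp add: power_less_one_iff abs_square_less_1)
  have \<eta>: "0 < \<eta>"
  proof -
    have "0 < (1 - (cmod z0)\<^sup>2) / 4 * (1 - (cmod \<alpha>)\<^sup>2)"
      using \<alpha>2 z0(2) by (simp add: abs_square_less_1)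
    also have "\<dots> \<le> \<eta>"
      using one_minus_blaschke_square_bounds(1)[of z0 \<alpha>] z0 \<alpha> by (simp add: \<eta>_def w_def)
    finally show ?thesis .
  qed
  have c1: "cmod c \<le> 1" using \<eta> by (simp add: \<eta>_def c_def abs_square_less_1 less_imp_le)
  have h\<alpha>: "h \<alpha> = of_real \<eta>"
    using w0[of \<alpha>] \<alpha> unfolding h_def c_def \<eta>_def of_real_diff complex_norm_square
    by (simp add: mult.commute)
  have cont_w: "continuous_on X w"
    unfolding w_def by (intro continuous_intros) (use denom[OF z0(2)] X1 in auto)
  have "continuous_on X h"
    unfolding h_def by (intro continuous_intros cont_w) (use wX in auto)
  then obtain K where K: "0 < K" "\<And>z. z \<in> X \<Longrightarrow> cmod (h z) \<le> K"
    using compact_continuous_bounded[OF X(1)] by blast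
  have "continuous_on X (\<lambda>z. 1 / w z)"
    by (intro continuous_intros cont_w) (use wX in auto)
  then obtain L where L: "0 < L" "\<And>z. z \<in> X \<Longrightarrow> cmod (1 / w z) \<le> L"
    using compact_continuous_bounded[OF X(1)] by blast
  \<comment> \<open>\<open>C\<close> is chosen to give \<open>Re (h z) <= C * (1 - |z|^2)\<close> on
    \<open>X\<close>, and \<open>k\<close> to give
    \<open>1 - |b z|^2 >= k * (1 - |z|^2)\<close>.\<close>
  define C where "C = L / (1 - cmod z0)\<^sup>2"
  define k where "k = (1 - (cmod \<alpha>)\<^sup>2) / 4"
  have k: "0 < k" using \<alpha>2 by (simp add: k_def)
  have k1: "k \<le> 1" unfolding k_def by (rule order_trans[of _ "1 / 4"]) simp_all
  have C: "0 \<le> C" using L(1) by (simp add: C_def)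
  \<comment> \<open>The second condition lets the loss in \<open>b\<close> absorb the first-order
    gain; the third keeps the second-order term below the growth \<open>t * \<eta>\<close> at
    \<alpha>.\<close>
  obtain t where t: "0 < t" "2 * t * C \<le> k" "t * K\<^sup>2 \<le> \<eta>"
    using small_parameter[OF C, of "K\<^sup>2" k \<eta>] K(1) k \<eta> by auto
  have bound: "cmod (b z * (1 + of_real t * h z)) \<le> sqrt (1 + t\<^sup>2 * K\<^sup>2)" if z: "z \<in> X" for z
  proof -
    define E where "E = 1 - (cmod z)\<^sup>2"
    have E: "0 \<le> E" "E \<le> 1" using X1[OF z] by (simp_all add: E_def power_le_one)
    have b: "(cmod (b z))\<^sup>2 \<le> 1 - k * E"
      using one_minus_blaschke_square_bounds(1)[OF \<alpha>(1) X1[OF z]] by (simp add: b_def k_def E_def)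
    have wE: "1 - (cmod (w z))\<^sup>2 \<le> E / (1 - cmod z0)\<^sup>2"
      using one_minus_blaschke_square_bounds(2)[OF z0(2) X1[OF z]] by (simp add: w_def E_def)
    have "0 \<le> (1 - (cmod z0)\<^sup>2) / 4 * E"
      using E(1) z0(2) by (intro mult_nonneg_nonneg) (simp_all add: power_le_one)
    also have "\<dots> \<le> 1 - (cmod (w z))\<^sup>2"
      using one_minus_blaschke_square_bounds(1)[OF z0(2) X1[OF z]] by (simp add: w_def E_def)
    finally have w1: "0 \<le> 1 - (cmod (w z))\<^sup>2" .
    have "Re (h z) \<le> (1 - (cmod (w z))\<^sup>2) / cmod (w z)"
      unfolding h_def using w1 by (intro Re_diff_reflection_le wX z c1) (simp add: abs_square_le_1)
    also have "\<dots> = cmod (1 / w z) * (1 - (cmod (w z))\<^sup>2)" by (simp add: norm_divide)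
    also have "\<dots> \<le> L * (E / (1 - cmod z0)\<^sup>2)"
      using w1 wE L z by (intro mult_mono) auto
    finally have Reh: "Re (h z) \<le> C * E" by (simp add: C_def)
    have "(cmod (1 + of_real t * h z))\<^sup>2 \<le> 1 + 2 * t * (C * E) + t\<^sup>2 * K\<^sup>2"
      unfolding cmod_one_plus_square using Reh K(2)[OF z] t(1)
      by (intro add_mono mult_left_mono power_mono) auto
    also have "\<dots> \<le> 1 + k * E + t\<^sup>2 * K\<^sup>2"
      using mult_right_mono[OF t(2) E(1)] by (simp add: mult_ac)
    finally have "(cmod (b z * (1 + of_real t * h z)))\<^sup>2 \<le> (1 - k * E) * (1 + k * E + t\<^sup>2 * K\<^sup>2)"
      unfolding norm_mult power_mult_distrib using b k k1 E
      by (intro mult_mono) (auto simp: mult_le_one)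
    \<comment> \<open>The first-order terms in \<open>k * E\<close> cancel, leaving only nonpositive
      corrections to \<open>1 + t^2 K^2\<close>.\<close>
    also have "\<dots> = 1 + t\<^sup>2 * K\<^sup>2 - (k * E)\<^sup>2 - (k * E) * (t\<^sup>2 * K\<^sup>2)"
      by (simp add: power2_eq_square algebra_simps)
    also have "\<dots> = 1 + t\<^sup>2 * K\<^sup>2 - ((k * E)\<^sup>2 + (k * E) * (t\<^sup>2 * K\<^sup>2))" by simp
    also have "\<dots> \<le> 1 + t\<^sup>2 * K\<^sup>2" using k E unfolding diff_le_eq le_add_same_cancel1
      by (intro add_nonneg_nonneg) simp_all
    finally show ?thesis by (rule real_le_rsqrt)
  qed
  define u v where "u = [:- z0, 1:]" and "v = [:1, - cnj z0:]"
  \<comment> \<open>Numerator of \<open>1 + t h\<close> over the common denominator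
    \<open>u * v\<close>, where \<open>w = u / v\<close>.\<close>
  define g where "g = u * v + Polynomial.smult (of_real t) (Polynomial.smult c (u * u) - Polynomial.smult (cnj c) (v * v))"
  define p where "p = [:- \<alpha>, 1:] * g"
  define q where "q = [:1, - cnj \<alpha>:] * (u * v)"
  have uv: "poly u z = z - z0" "poly v z = 1 - cnj z0 * z" "w z = poly u z / poly v z" for z
    by (simp_all add: u_def v_def w_def mult.commute)
  have q: "poly q z = (1 - cnj \<alpha> * z) * (poly u z * poly v z)" for z
    by (simp add: q_def algebra_simps)
  have nz: "poly u z \<noteq> 0" "poly v z \<noteq> 0" "1 - cnj \<alpha> * z \<noteq> 0" if "cmod z \<le> 1" "z \<noteq> z0" for z
    using denom[OF z0(2) that(1)] denom[OF \<alpha>(1) that(1)] that(2) by (simp_all add: uv)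
  have g: "poly g z / (poly u z * poly v z) = 1 + of_real t * h z" if "cmod z \<le> 1" "z \<noteq> z0" for z
    using nz[OF that] by (simp add: g_def h_def uv(3) add_divide_distrib) (simp add: field_simps)
  have "poly q z \<noteq> 0" if "cmod z \<le> 1" "z \<noteq> z0" for z using nz[OF that] by (simp add: q)
  then have "\<forall>z\<in>X. poly q z \<noteq> 0" "poly q \<alpha> \<noteq> 0" using X1 z0(1) \<alpha> by (auto simp: less_imp_le)
  then have "(p, q) \<in> Rat X" by (auto simp: Rat_def)
  have "rat_eval (p, q) z = b z * (1 + of_real t * h z)" if "z \<in> X" for z
  proof -
    have "z \<noteq> z0" using that z0(1) by auto
    from g[OF X1[OF that] this, symmetric] show ?thesis
      by (simp add: rat_eval_def p_def q b_def left_diff_distrib)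
  qed
  with bound have "\<And>z. z \<in> X \<Longrightarrow> cmod (rat_eval (p, q) z) \<le> sqrt (1 + t\<^sup>2 * K\<^sup>2)" by simp
  \<comment> \<open>An empty \<open>X\<close> is covered by the value 0 of
    \<open>sup_norm\<close>.\<close>
  then have "sup_norm X (rat_eval (p, q)) \<le> sqrt (1 + t\<^sup>2 * K\<^sup>2)"
    by (auto simp: sup_norm_def intro: cSUP_least)
  also have "\<dots> < sqrt ((1 + t * \<eta>)\<^sup>2)"
  proof (rule real_sqrt_less_mono)
    have "t * (t * K\<^sup>2) \<le> t * \<eta>" using t by (intro mult_left_mono) auto
    then have "1 + t\<^sup>2 * K\<^sup>2 \<le> 1 + t * \<eta>" by (simp add: power2_eq_square mult_ac)
    also have "\<dots> < (1 + t * \<eta>)\<^sup>2"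
      using mult_pos_pos[OF t(1) \<eta>] power_strict_increasing[of 1 2 "1 + t * \<eta>"] by simp
    finally show "1 + t\<^sup>2 * K\<^sup>2 < (1 + t * \<eta>)\<^sup>2" .
  qed
  also have "\<dots> = cmod (1 + of_real t * h \<alpha>)"
  proof -
    have "1 + of_real t * h \<alpha> = of_real (1 + t * \<eta>)" by (simp add: h\<alpha>)
    then show ?thesis by (simp only: norm_of_real real_sqrt_abs)
  qed
  also have "1 + of_real t * h \<alpha> = of_real (1 - (cmod \<alpha>)\<^sup>2) * poly (pderiv p) \<alpha> / poly q \<alpha>"
  proof -
    \<comment> \<open>Differentiating \<open>(X - \<alpha>) g\<close> at \<alpha> leaves the value
      of \<open>g\<close>, and the weight \<open>1 - |\<alpha>|^2\<close> cancels the Blaschke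
      denominator contained in \<open>q\<close>.\<close>
    have "poly (pderiv p) \<alpha> = poly g \<alpha>"
      unfolding p_def pderiv_mult by (simp add: pderiv_pCons del: mult_pCons_left mult_pCons_right)
    moreover have "of_real (1 - (cmod \<alpha>)\<^sup>2) = 1 - cnj \<alpha> * \<alpha>"
      unfolding of_real_diff complex_norm_square by (simp add: mult.commute)
    ultimately show ?thesis
      using g[of \<alpha>, symmetric] nz(3)[of \<alpha>] \<alpha> by (simp add: q)
  qed
  finally show ?thesis
    using that[OF \<open>(p, q) \<in> Rat X\<close> _ \<open>poly q \<alpha> \<noteq> 0\<close>] by (simp add: p_def)
qed

section \<open>Test operators for a point missing from the set\<close>

text \<open>The complex numbers and their square are equinumerous, so room for \<open>C\<close> in
  the universe is room for \<open>C^2\<close>.\<close>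

lemma plane_embeds:
  fixes e :: "complex \<Rightarrow> 'a"
  assumes "inj e"
  obtains \<phi> :: "complex \<times> complex \<Rightarrow> 'a" where "inj \<phi>"
proof -
  have "infinite (UNIV :: complex set)" by (rule infinite_UNIV_char_0)
  from card_of_Times_same_infinite[OF this]
  obtain f :: "complex \<times> complex \<Rightarrow> complex" where "bij_betw f (UNIV \<times> UNIV) UNIV"
    unfolding card_of_ordIso[symmetric] by blast
  then have "inj f" by (simp add: bij_betw_def)
  with assms show ?thesis using that inj_compose by blast
qed

text \<open>The injection \<open>e\<close> provides nonzero Hilbert spaces. If \<open>'a\<close>
  carried only zero spaces, the empty set would be spectral for every member and the disc would not
  be minimal.\<close>

theorem theorem5p8:
  fixes r :: real and e :: "complex \<Rightarrow> 'a"
  assumes r: "0 < r" "r < 1"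
    and large_universe: "inj e"
  shows "minimal_spectral_set (cball 0 1) (C1 r :: 'a op_class)"
proof -
  obtain \<phi> :: "complex \<times> complex \<Rightarrow> 'a" where \<phi>: "inj \<phi>"
    using plane_embeds[OF large_universe] by blast
  have "\<exists>(H, T)\<in>(C1 r :: 'a op_class). \<not> spectral_set X H T"
    if X: "compact X" "X \<subset> cball 0 1" for X
  proof -
    obtain z0 where z0: "z0 \<in> cball 0 1" "z0 \<notin> X" using X(2) by blast
    show ?thesis
    proof (cases "r \<le> cmod z0")
      case True
      then have "z0 \<noteq> 0" using r by auto
      moreover have "(r / cmod z0)\<^sup>2 \<le> 1" "(cmod z0)\<^sup>2 \<le> 1"
        using True r z0(1) by (auto intro!: power_le_one simp: divide_le_eq)
      ultimately have "(plane \<phi>, jordan \<phi> z0 0) \<in> C1 r"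
        using r by (intro jordan_in_C1[OF \<phi>]) auto
      moreover have "\<not> spectral_set X (plane \<phi>) (jordan \<phi> z0 0)"
        using eigenvalue_in_spectrum[OF \<phi>] z0(2) by (auto simp: spectral_set_def)
      ultimately show ?thesis by blast
    next
      case False
      \<comment> \<open>For \<open>|a|^2 = r\<close> the two norm conditions of
        \<open>jordan_in_C1\<close> coincide, both reading \<open>|s| <= 1 - r\<close>;
        \<open>s\<close> takes the extreme value, which is also the weight in
        \<open>rational_peak\<close>.\<close>
      define a s :: complex where "a = of_real (sqrt r)" and "s = of_real (1 - (cmod a)\<^sup>2)"
      have a: "cmod a = sqrt r" "(cmod a)\<^sup>2 = r" using r by (simp_all add: a_def)
      have s: "cmod s = 1 - r" using r unfolding s_def a(2) norm_of_real by simp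
      \<comment> \<open>Thus \<open>|z0| < r <= sqrt r = |a|\<close>, which separates
        \<open>a\<close> from \<open>z0\<close>.\<close>
      have "r \<le> sqrt r" using r by (intro real_le_rsqrt) (simp add: power2_eq_square mult_left_le)
      then have "a \<noteq> z0" "cmod a < 1" "cmod z0 < 1" using False r a(1) by auto
      then obtain p q where pq: "(p, q) \<in> Rat X" "poly p a = 0" "poly q a \<noteq> 0"
          "sup_norm X (rat_eval (p, q)) < cmod (s * poly (pderiv p) a / poly q a)"
        using rational_peak[OF X(1) psubset_imp_subset[OF X(2)] z0(2), of a] unfolding s_def by blast
      note pq(4)
      also have "cmod (s * poly (pderiv p) a / poly q a)
          \<le> op_norm (plane \<phi>) (rat_op (plane \<phi>) (p, q) (jordan \<phi> a s))"
        by (rule op_norm_rat_op_jordan_ge[OF \<phi> pq(2,3)])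
      finally have "\<not> spectral_set X (plane \<phi>) (jordan \<phi> a s)"
        using pq(1) by (auto simp: spectral_set_def not_le)
      moreover have "(plane \<phi>, jordan \<phi> a s) \<in> C1 r"
        using r a s by (intro jordan_in_C1[OF \<phi>]) (auto simp: power_divide power2_eq_square)
      ultimately show ?thesis by blast
    qed
  qed
  then show ?thesis
    using C1_spectral_set_disc by (fastforce simp: minimal_spectral_set_def)
qed

end
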